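(* Assume that $P_X$ is non-degenerate and that $n\ge d$. Then $$\inf_{\widehat\beta_n}\ \sup_{P\in\mathcal P_{\mathrm{Gauss}}(P_X,\sigma^2)}\mathbb E\big[\mathcal E_P(\widehat\beta_n)\big]\;\ge\;\frac{\sigma^2 d}{n-d+1}.$$
   Context: Let $n,d\ge 1$ be integers, $\sigma^2>0$, and let $P_X$ be a probability distribution on $\mathbb R^d$ such that, for $X\sim P_X$, $\mathbb E\|X\|^2<\infty$ and $\Sigma:=\mathbb E[XX^\top]$ is invertible. $P_X$ is called degenerate if there is $\theta\in\mathbb R^d$, $\|\theta\|=1$, with $\mathbb P(\langle\theta,X\rangle=0)>0$; otherwise it is non-degenerate. The class $\mathcal P_{\mathrm{Gauss}}(P_X,\sigma^2)$ consists of all joint distributions $P$ of $(X,Y)$ with $X\sim P_X$ and $Y=\langle\beta^*,X\rangle+\varepsilon$, where $\beta^*\in\mathbb R^d$ is arbitrary and $\varepsilon\,|\,X\sim\mathcal N(0,\sigma^2)$. The risk of $\beta\in\mathbb R^d$ under $P$ is $R(\beta)=\mathbb E[(Y-\langle\beta,X\rangle)^2]$; it is uniquely minimized at $\beta^*$, and the excess risk is $\mathcal E_P(\beta)=R(\beta)-R(\beta^* )=\|\Sigma^{1/2}(\beta-\beta^* )\|^2$. An estimator $\widehat\beta_n$ is an $\mathbb R^d$-valued measurable function of an i.i.d. sample $(X_1,Y_1),\dots,(X_n,Y_n)$ from $P$; the infimum is over all estimators and the expectation is over the sample. *)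

theory Defs
  imports "HOL-Probability.Probability"
begin

text \<open>The joint laws of \<open>(X, Y)\<close> are Borel probability measures on \<open>(real^'d) \<times> real\<close>, and the dimension
  \<open>d\<close> is \<open>CARD('d)\<close>.\<close>

definition second_moment_matrix :: "(real^'d) measure \<Rightarrow> real^'d^'d" where
  "second_moment_matrix PX = (\<chi> i j. \<integral>x. x $ i * x $ j \<partial>PX)"

definition degenerate :: "(real^'d) measure \<Rightarrow> bool" where
  "degenerate PX \<longleftrightarrow> (\<exists>\<theta>. norm \<theta> = 1 \<and> measure PX {x \<in> space PX. inner \<theta> x = 0} > 0)"

text \<open>The Markov kernel \<open>K\<close> is a regular conditional distribution of \<open>E\<close> given \<open>X\<close> under \<open>M\<close>.\<close>

definition has_cond_distr ::
  "'w measure \<Rightarrow> ('w \<Rightarrow> 'a::topological_space) \<Rightarrow> ('w \<Rightarrow> 'b::topological_space)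
    \<Rightarrow> ('a \<Rightarrow> 'b measure) \<Rightarrow> bool" where
  "has_cond_distr M X E K \<longleftrightarrow>
     X \<in> borel_measurable M \<and> E \<in> borel_measurable M \<and> K \<in> borel \<rightarrow>\<^sub>M prob_algebra borel \<and>
     (\<forall>A\<in>sets borel. \<forall>B\<in>sets borel.
        emeasure M {w \<in> space M. X w \<in> A \<and> E w \<in> B}
          = (\<integral>\<^sup>+w. indicator A (X w) * emeasure (K (X w)) B \<partial>M))"

text \<open>The second argument is the standard deviation.\<close>

definition gaussian :: "real \<Rightarrow> real \<Rightarrow> real measure" where
  "gaussian \<mu> \<sigma> = density lborel (\<lambda>t. ennreal (normal_density \<mu> \<sigma> t))"

definition gauss_class :: "(real^'d) measure \<Rightarrow> real \<Rightarrow> ((real^'d) \<times> real) measure set" where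
  "gauss_class PX \<sigma> =
     {P. prob_space P \<and> sets P = sets borel \<and> distr P borel fst = PX \<and>
         (\<exists>\<beta>. has_cond_distr P fst (\<lambda>(x, y). y - inner \<beta> x) (\<lambda>_. gaussian 0 \<sigma>))}"

definition risk :: "((real^'d) \<times> real) measure \<Rightarrow> real^'d \<Rightarrow> real" where
  "risk P \<beta> = (\<integral>(x, y). (y - inner \<beta> x)\<^sup>2 \<partial>P)"

definition risk_minimizer :: "((real^'d) \<times> real) measure \<Rightarrow> real^'d" where
  "risk_minimizer P = (THE \<beta>. is_arg_min (risk P) (\<lambda>_. True) \<beta>)"

definition excess_risk :: "((real^'d) \<times> real) measure \<Rightarrow> real^'d \<Rightarrow> real" where
  "excess_risk P \<beta> = risk P \<beta> - risk P (risk_minimizer P)"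

definition estimators :: "nat \<Rightarrow> ((nat \<Rightarrow> (real^'d) \<times> real) \<Rightarrow> real^'d) set" where
  "estimators n = borel_measurable (\<Pi>\<^sub>M i\<in>{..<n}. borel)"

text \<open>The loss may fail to be integrable for a given estimator, so the expectation over the sample
  takes values in \<open>[0, \<infinity>]\<close>; \<open>excess_risk\<close> is nonnegative on the class considered, so
  \<open>ennreal\<close> truncates nothing.\<close>

definition expected_excess_risk ::
  "nat \<Rightarrow> ((real^'d) \<times> real) measure \<Rightarrow> ((nat \<Rightarrow> (real^'d) \<times> real) \<Rightarrow> real^'d) \<Rightarrow> ennreal" where
  "expected_excess_risk n P bhat =
     (\<integral>\<^sup>+s. ennreal (excess_risk P (bhat s)) \<partial>(\<Pi>\<^sub>M i\<in>{..<n}. P))"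

end

theory Submission
  imports Defs
begin

text \<open>The worst-case risk is at least the average risk under any prior on the coefficient vector \<open>\<beta>\<close>. Under the
  normal prior with covariance \<open>\<tau>\<^sup>2\<close> times the identity, and for a fixed design \<open>x\<^sub>1, \<dots>, x\<^sub>n\<close>, the posterior
  is symmetric about the ridge estimate with penalty \<open>l = \<sigma>\<^sup>2 / \<tau>\<^sup>2\<close>. That estimate is therefore optimal, and its
  mean squared error in predicting \<open>\<langle>\<beta>, z\<rangle>\<close> is \<open>\<sigma>\<^sup>2 \<langle>(l + S)\<^sup>-\<^sup>1 z, z\<rangle>\<close> with \<open>S = \<Sum>\<^sub>i x\<^sub>i x\<^sub>i\<^sup>T\<close>
  (\<open>bayes_risk_fixed_design\<close>). The excess risk is the mean squared prediction error at a fresh covariate,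
  so the expectation of \<open>\<langle>(l + S)\<^sup>-\<^sup>1 z, z\<rangle>\<close> for a fresh covariate \<open>z\<close> has to be bounded from below.

  This quantity equals \<open>h / (1 - h)\<close>, where \<open>h\<close> is the leverage of \<open>z\<close> in the design enlarged by \<open>z\<close>. A
  convex function lies above its tangents (\<open>ridge_variance_ge_leverage_tangent\<close>), so only the mean of \<open>h\<close>
  matters. The \<open>n + 1\<close> leverages of the enlarged design have the same mean by exchangeability, and their sum
  is the trace of \<open>(l + S)\<^sup>-\<^sup>1 S\<close> for the enlarged \<open>S\<close>, which is \<open>d\<close> up to a term of the form
  \<open>l\<close> times the trace of \<open>(l + S)\<^sup>-\<^sup>1\<close> (\<open>sum_leverage\<close>).

  Since \<open>P\<^sub>X\<close> is non-degenerate, \<open>n + 1 \<ge> d\<close> covariates almost surely span the space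
  (\<open>AE_span_eq_UNIV\<close>), so this term disappears as the prior becomes flat, \<open>l \<rightarrow> 0\<close>. The mean leverage then
  tends to \<open>d / (n + 1)\<close>, at which \<open>h / (1 - h)\<close> has the value \<open>d / (n - d + 1)\<close>.\<close>

section \<open>Ridge operators and leverages\<close>

text \<open>The operator \<open>l + \<Sum>\<^sub>i x\<^sub>i x\<^sub>i\<^sup>T\<close>, acting on vectors so that it makes sense in any Euclidean space and
  without choosing coordinates. For \<open>l = 0\<close> it is the Gram operator of the design.\<close>

definition ridge_op :: "real \<Rightarrow> 'i set \<Rightarrow> ('i \<Rightarrow> 'a::euclidean_space) \<Rightarrow> 'a \<Rightarrow> 'a" where
  "ridge_op l I x v = l *\<^sub>R v + (\<Sum>i\<in>I. (x i \<bullet> v) *\<^sub>R x i)"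

lemma linear_ridge_op: "linear (ridge_op l I x)"
  by (intro linearI)
    (simp_all add: ridge_op_def inner_right_distrib scaleR_left_distrib scaleR_right_distrib
      sum.distrib scaleR_sum_right mult.commute)

lemma inner_ridge_op: "v \<bullet> ridge_op l I x w = l * (v \<bullet> w) + (\<Sum>i\<in>I. (x i \<bullet> v) * (x i \<bullet> w))"
  by (simp add: ridge_op_def inner_right_distrib inner_sum_right inner_commute mult.commute)

lemma ridge_op_symmetric: "v \<bullet> ridge_op l I x w = ridge_op l I x v \<bullet> w"
  by (simp add: inner_ridge_op inner_commute[of "ridge_op l I x v"] inner_commute mult.commute)

lemma ridge_op_quadratic: "v \<bullet> ridge_op l I x v = l * (v \<bullet> v) + (\<Sum>i\<in>I. (x i \<bullet> v)\<^sup>2)"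
  by (simp add: inner_ridge_op power2_eq_square)

lemma ridge_op_quadratic_nonneg: "0 \<le> l \<Longrightarrow> 0 \<le> v \<bullet> ridge_op l I x v"
  unfolding ridge_op_quadratic by (intro add_nonneg_nonneg mult_nonneg_nonneg sum_nonneg) auto

lemma bij_ridge_op:
  fixes x :: "'i \<Rightarrow> 'a::euclidean_space"
  assumes "0 < l"
  shows "bij (ridge_op l I x)"
proof -
  have "v = 0" if "ridge_op l I x v = 0" for v
  proof -
    have "l * (v \<bullet> v) \<le> v \<bullet> ridge_op l I x v"
      unfolding ridge_op_quadratic by (simp add: sum_nonneg)
    with that assms have "v \<bullet> v \<le> 0"
      by (simp add: mult_le_0_iff)
    then show "v = 0" using inner_ge_zero[of v] by (metis antisym inner_eq_zero_iff)
  qed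
  then have inj: "inj (ridge_op l I x)"
    using linear_ridge_op[of l I x] by (simp add: linear_injective_0)
  then show ?thesis
    using linear_injective_imp_surjective[OF linear_ridge_op inj] by (simp add: bij_def)
qed

definition ridge_solve :: "real \<Rightarrow> 'i set \<Rightarrow> ('i \<Rightarrow> 'a::euclidean_space) \<Rightarrow> 'a \<Rightarrow> 'a" where
  "ridge_solve l I x = inv (ridge_op l I x)"

lemma ridge_op_solve [simp]: "0 < l \<Longrightarrow> ridge_op l I x (ridge_solve l I x z) = z"
  unfolding ridge_solve_def using bij_ridge_op[of l I x] by (simp add: bij_is_surj surj_f_inv_f)

text \<open>A diagonal entry of the hat matrix of ridge regression with penalty \<open>l\<close>.\<close>

definition leverage :: "real \<Rightarrow> 'i set \<Rightarrow> ('i \<Rightarrow> 'a::euclidean_space) \<Rightarrow> 'i \<Rightarrow> real" where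
  "leverage l I x i = ridge_solve l I x (x i) \<bullet> x i"

lemma ridge_op_insert:
  "finite I \<Longrightarrow> k \<notin> I \<Longrightarrow> ridge_op l (insert k I) x v = ridge_op l I x v + (x k \<bullet> v) *\<^sub>R x k"
  by (simp add: ridge_op_def)

text \<open>With \<open>a\<close> the solution for \<open>x\<^sub>k\<close>, the leverage \<open>h\<close> is the quadratic form at \<open>a\<close>, of which the term of
  index \<open>k\<close> alone is already \<open>h\<^sup>2\<close>; hence \<open>h\<^sup>2 \<le> h\<close>.\<close>

lemma leverage_bounds:
  assumes "0 < l" "finite I" "k \<in> I"
  shows "0 \<le> leverage l I x k" "leverage l I x k \<le> 1"
proof -
  define a where "a = ridge_solve l I x (x k)"
  define h where "h = a \<bullet> x k"
  have "h = a \<bullet> ridge_op l I x a"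
    using assms by (simp add: a_def h_def)
  then have q: "h = l * (a \<bullet> a) + (\<Sum>i\<in>I. (x i \<bullet> a)\<^sup>2)"
    by (simp add: ridge_op_quadratic)
  have "(x k \<bullet> a)\<^sup>2 \<le> (\<Sum>i\<in>I. (x i \<bullet> a)\<^sup>2)"
    using assms by (intro member_le_sum) auto
  moreover have "0 \<le> l * (a \<bullet> a)" using assms by simp
  ultimately have *: "h\<^sup>2 \<le> h" using q by (simp add: h_def inner_commute)
  then have "0 \<le> h" by (smt (verit) zero_le_power2)
  moreover have "h \<le> 1"
  proof (rule ccontr)
    assume "\<not> h \<le> 1"
    then have "h * 1 < h * h" by (intro mult_strict_left_mono) auto
    with * show False by (simp add: power2_eq_square)
  qed
  ultimately show "0 \<le> leverage l I x k" "leverage l I x k \<le> 1"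
    by (simp_all add: leverage_def h_def a_def)
qed

text \<open>By the Sherman-Morrison formula the right-hand side is \<open>h / (1 - h)\<close> for the leverage \<open>h\<close> of \<open>x\<^sub>k\<close> in
  the design enlarged by \<open>x\<^sub>k\<close>, and the left-hand side is the tangent to that convex function at \<open>h0\<close>.
  The proof needs no division by \<open>1 - h\<close>: it evaluates the nonnegative quadratic form of the small
  design at \<open>u - t a\<close>, where \<open>u\<close> and \<open>a\<close> are the solutions for the small and for the enlarged design.\<close>

lemma ridge_variance_ge_leverage_tangent:
  assumes l: "0 < l" and I: "finite I" "k \<notin> I" and t: "t * (1 - h0) = 1"
  shows "t\<^sup>2 * (leverage l (insert k I) x k - h0\<^sup>2) \<le> ridge_solve l I x (x k) \<bullet> x k"
proof -
  define z u a h where "z = x k" and "u = ridge_solve l I x z"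
    and "a = ridge_solve l (insert k I) x z" and "h = a \<bullet> z"
  have u: "ridge_op l I x u = z" using l by (simp add: u_def)
  have "ridge_op l (insert k I) x a = z" using l by (simp add: a_def)
  then have a: "ridge_op l I x a = (1 - h) *\<^sub>R z"
    using I by (simp add: ridge_op_insert z_def[symmetric] h_def inner_commute algebra_simps)
  have "0 \<le> (u - t *\<^sub>R a) \<bullet> ridge_op l I x (u - t *\<^sub>R a)"
    using l by (intro ridge_op_quadratic_nonneg) auto
  also have "\<dots> = (u - t *\<^sub>R a) \<bullet> (z - (t * (1 - h)) *\<^sub>R z)"
    using linear_ridge_op[of l I x] by (simp add: linear_diff linear_scale u a)
  also have "\<dots> = (u \<bullet> z - t * h) * (1 - t * (1 - h))"
    by (simp add: h_def inner_diff_left inner_diff_right algebra_simps)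
  also have "\<dots> = u \<bullet> z - (t * (1 - h) * (u \<bullet> z) + t * h * (1 - t * (1 - h)))"
    by (simp add: algebra_simps)
  also have "(1 - h) * (u \<bullet> z) = h"
  proof -
    have "(1 - h) * (u \<bullet> z) = u \<bullet> ridge_op l I x a" by (simp add: a)
    also have "\<dots> = h" using u by (simp add: ridge_op_symmetric h_def inner_commute)
    finally show ?thesis .
  qed
  then have "t * (1 - h) * (u \<bullet> z) = t * h" by (simp add: mult.assoc)
  finally have "2 * t * h - t\<^sup>2 * h * (1 - h) \<le> u \<bullet> z"
    by (simp add: power2_eq_square algebra_simps)
  moreover have "2 * t * h - t\<^sup>2 * h * (1 - h) - t\<^sup>2 * (h - h0\<^sup>2) = t\<^sup>2 * (h - h0)\<^sup>2"
  proof -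
    have "t = t\<^sup>2 * (1 - h0)" using t by (simp add: power2_eq_square mult.assoc)
    then have "2 * t * h = 2 * (t\<^sup>2 * (1 - h0)) * h" by simp
    then show ?thesis by (simp add: power2_eq_square algebra_simps)
  qed
  ultimately have "t\<^sup>2 * (h - h0\<^sup>2) \<le> u \<bullet> z"
    by (smt (verit) zero_le_power2 mult_nonneg_nonneg)
  then show ?thesis by (simp add: leverage_def h_def a_def u_def z_def)
qed

text \<open>The sum is the trace of \<open>(l + S)\<^sup>-\<^sup>1 S = 1 - l (l + S)\<^sup>-\<^sup>1\<close>, where \<open>S\<close> is the Gram operator.\<close>

lemma sum_leverage:
  fixes x :: "'i \<Rightarrow> 'a::euclidean_space"
  assumes l: "0 < l"
  shows "(\<Sum>i\<in>I. leverage l I x i) = DIM('a) - (\<Sum>b\<in>Basis. l * (ridge_solve l I x b \<bullet> b))"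
proof -
  have sym: "ridge_solve l I x (x i) \<bullet> b = x i \<bullet> ridge_solve l I x b" for i b
    using ridge_op_symmetric[of "ridge_solve l I x (x i)" l I x "ridge_solve l I x b"] l by simp
  have "(\<Sum>i\<in>I. leverage l I x i) = (\<Sum>i\<in>I. \<Sum>b\<in>Basis. (x i \<bullet> ridge_solve l I x b) * (x i \<bullet> b))"
    unfolding leverage_def by (subst euclidean_inner) (simp add: sym)
  also have "\<dots> = (\<Sum>b\<in>Basis. \<Sum>i\<in>I. (x i \<bullet> b) * (x i \<bullet> ridge_solve l I x b))"
    by (subst sum.swap) (simp add: mult.commute)
  also have "\<dots> = (\<Sum>b\<in>Basis. 1 - l * (ridge_solve l I x b \<bullet> b))"
  proof (intro sum.cong refl)
    fix b :: 'a assume b: "b \<in> Basis"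
    have "b \<bullet> ridge_op l I x (ridge_solve l I x b) = 1" using l b by simp
    then show "(\<Sum>i\<in>I. (x i \<bullet> b) * (x i \<bullet> ridge_solve l I x b)) = 1 - l * (ridge_solve l I x b \<bullet> b)"
      unfolding inner_ridge_op by (simp add: inner_commute algebra_simps)
  qed
  finally show ?thesis by (simp add: sum_subtractf)
qed

text \<open>These are the diagonal entries of \<open>l (l + S)\<^sup>-\<^sup>1\<close>, by whose sum the leverages fall short of the
  dimension. The bounds later serve as a dominating function for \<open>l \<rightarrow> 0\<close>.\<close>

lemma ridge_bias_bounds:
  assumes l: "0 < l" and "b \<in> Basis"
  shows "0 \<le> l * (ridge_solve l I x b \<bullet> b)" "l * (ridge_solve l I x b \<bullet> b) \<le> 1"
proof -
  define u where "u = ridge_solve l I x b"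
  have "u \<bullet> b = u \<bullet> ridge_op l I x u" using l by (simp add: u_def)
  then have q: "u \<bullet> b = l * (u \<bullet> u) + (\<Sum>i\<in>I. (x i \<bullet> u)\<^sup>2)" by (simp add: ridge_op_quadratic)
  have "(u \<bullet> b)\<^sup>2 \<le> u \<bullet> u"
    using Cauchy_Schwarz_ineq[of u b] assms by simp
  then have "l * (u \<bullet> b)\<^sup>2 \<le> l * (u \<bullet> u)" using l by simp
  also have "\<dots> \<le> u \<bullet> b" using q by (simp add: sum_nonneg)
  finally have *: "l * (u \<bullet> b)\<^sup>2 \<le> u \<bullet> b" .
  have "0 \<le> u \<bullet> b" using q l by (simp add: sum_nonneg)
  moreover have "l * (u \<bullet> b) \<le> 1"
  proof (cases "u \<bullet> b = 0")
    case False
    then show ?thesis using * \<open>0 \<le> u \<bullet> b\<close> by (simp add: power2_eq_square mult.assoc[symmetric])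
  qed simp
  ultimately show "0 \<le> l * (ridge_solve l I x b \<bullet> b)" "l * (ridge_solve l I x b \<bullet> b) \<le> 1"
    using l by (simp_all add: u_def)
qed

lemma span_eq_UNIV_iff_orthogonal:
  fixes S :: "'a::euclidean_space set"
  shows "span S = UNIV \<longleftrightarrow> (\<forall>v. (\<forall>s\<in>S. s \<bullet> v = 0) \<longrightarrow> v = 0)"
proof
  assume "span S = UNIV"
  then show "\<forall>v. (\<forall>s\<in>S. s \<bullet> v = 0) \<longrightarrow> v = 0"
    using orthogonal_to_span[of _ S] by (metis UNIV_I inner_commute orthogonal_def orthogonal_self)
next
  assume *: "\<forall>v. (\<forall>s\<in>S. s \<bullet> v = 0) \<longrightarrow> v = 0"
  show "span S = UNIV"
  proof (rule ccontr)
    assume "span S \<noteq> UNIV"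
    then obtain v where "v \<noteq> 0" "\<forall>s\<in>span S. v \<bullet> s = 0"
      using span_not_UNIV_orthogonal by blast
    with * show False by (metis inner_commute span_base)
  qed
qed

text \<open>A spanning design makes the Gram operator invertible, so \<open>b\<close> has a preimage \<open>s\<close> under it. The pairing
  of \<open>b\<close> with its ridge solution is at most \<open>\<langle>s, b\<rangle>\<close>, whatever the penalty.\<close>

lemma ridge_bias_tendsto_0:
  fixes x :: "'i \<Rightarrow> 'a::euclidean_space"
  assumes l: "\<And>n. 0 < l n" "l \<longlonglongrightarrow> 0" and I: "finite I" and span: "span (x ` I) = UNIV" and b: "b \<in> Basis"
  shows "(\<lambda>n. l n * (ridge_solve (l n) I x b \<bullet> b)) \<longlonglongrightarrow> 0"
proof -
  obtain s where s: "b = ridge_op 0 I x s"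
  proof -
    have "v = 0" if "ridge_op 0 I x v = 0" for v
    proof -
      have "(\<Sum>i\<in>I. (x i \<bullet> v)\<^sup>2) = 0" using ridge_op_quadratic[of v 0 I x] that by simp
      then have "\<forall>w\<in>x ` I. w \<bullet> v = 0" using I by (simp add: sum_nonneg_eq_0_iff)
      then show "v = 0" using span unfolding span_eq_UNIV_iff_orthogonal by blast
    qed
    then have "surj (ridge_op 0 I x)"
      using linear_ridge_op[of 0 I x] by (simp add: linear_injective_0 linear_injective_imp_surjective)
    then show ?thesis using that by (metis surjD)
  qed
  have bound: "l n * (ridge_solve (l n) I x b \<bullet> b) \<le> l n * (s \<bullet> b)" for n
  proof -
    define u where "u = ridge_solve (l n) I x b"
    have u: "ridge_op (l n) I x u = b" using l by (simp add: u_def)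
    have op: "ridge_op (l n) I x v = ridge_op 0 I x v + l n *\<^sub>R v" for v by (simp add: ridge_op_def)
    have "ridge_op (l n) I x (s - u) = l n *\<^sub>R s"
      using linear_ridge_op[of "l n" I x] op[of s] s u by (simp add: linear_diff)
    then have "(s - u) \<bullet> (l n *\<^sub>R s) = l n * ((s - u) \<bullet> (s - u)) + (\<Sum>i\<in>I. (x i \<bullet> (s - u))\<^sup>2)"
      using ridge_op_quadratic[of "s - u" "l n" I x] by simp
    then have "l n * ((s - u) \<bullet> (s - u)) \<le> l n * ((s - u) \<bullet> s)" by (simp add: sum_nonneg)
    then have "(s - u) \<bullet> (s - u) \<le> (s - u) \<bullet> s" using l by simp
    then have "u \<bullet> u \<le> s \<bullet> u" by (simp add: inner_diff_left inner_diff_right inner_commute)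
    then have su: "0 \<le> s \<bullet> u" using inner_ge_zero[of u] by linarith
    have "u \<bullet> b - s \<bullet> b = - ((s - u) \<bullet> ridge_op (l n) I x u)" using u by (simp add: inner_diff_left)
    also have "\<dots> = - (l n * (s \<bullet> u))"
      by (simp add: ridge_op_symmetric \<open>ridge_op (l n) I x (s - u) = l n *\<^sub>R s\<close>)
    also have "\<dots> \<le> 0" using su l(1)[of n] by simp
    finally have "u \<bullet> b \<le> s \<bullet> b" by simp
    then show ?thesis using l(1)[of n] by (simp add: u_def)
  qed
  have "(\<lambda>n. 0) \<longlonglongrightarrow> (0::real)" "(\<lambda>n. l n * (s \<bullet> b)) \<longlonglongrightarrow> 0"
    using tendsto_mult_left_zero[OF l(2)] by simp_all
  show ?thesis
  proof (rule real_tendsto_sandwich)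
    show "eventually (\<lambda>n. 0 \<le> l n * (ridge_solve (l n) I x b \<bullet> b)) sequentially"
      by (intro always_eventually allI ridge_bias_bounds l b)
    show "eventually (\<lambda>n. l n * (ridge_solve (l n) I x b \<bullet> b) \<le> l n * (s \<bullet> b)) sequentially"
      by (intro always_eventually allI bound)
  qed fact+
qed

lemma ridge_op_permuted: "bij_betw p I I \<Longrightarrow> ridge_op l I (\<lambda>i. x (p i)) = ridge_op l I x"
  unfolding ridge_op_def by (intro ext arg_cong2[where f="(+)"] refl sum.reindex_bij_betw)

lemma leverage_permuted:
  assumes "bij_betw p I I"
  shows "leverage l I (\<lambda>i. x (p i)) i = leverage l I x (p i)"
  by (simp add: leverage_def ridge_solve_def ridge_op_permuted[OF assms])

lemma ridge_op_cong: "(\<And>i. i \<in> I \<Longrightarrow> x i = y i) \<Longrightarrow> ridge_op l I x = ridge_op l I y"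
  by (auto simp: ridge_op_def)

section \<open>Measurability of ridge solutions\<close>

lemma borel_measurable_vec_nth [measurable]: "(\<lambda>v::real^'d. v $ i) \<in> borel_measurable borel"
  by (intro borel_measurable_continuous_onI continuous_intros)

lemma borel_measurable_det:
  fixes A :: "'w \<Rightarrow> real^'d^'d"
  assumes [measurable]: "\<And>i j. (\<lambda>w. A w $ i $ j) \<in> borel_measurable M"
  shows "(\<lambda>w. det (A w)) \<in> borel_measurable M"
  unfolding det_def by measurable

lemma ridge_op_measurable:
  fixes g :: "'w \<Rightarrow> 'a::euclidean_space"
  assumes [measurable]: "\<And>i. i \<in> I \<Longrightarrow> (\<lambda>w. x w i) \<in> borel_measurable M" "g \<in> borel_measurable M"
  shows "(\<lambda>w. ridge_op l I (x w) (g w)) \<in> borel_measurable M"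
  unfolding ridge_op_def by measurable

text \<open>Cramer's rule writes the solution as a rational function of the design, which settles
  measurability without any continuity argument for operator inverses.\<close>

lemma ridge_solve_measurable:
  fixes g :: "'w \<Rightarrow> real^'d"
  assumes l: "0 < l" and x: "\<And>i. i \<in> I \<Longrightarrow> (\<lambda>w. x w i) \<in> borel_measurable M"
    and g: "g \<in> borel_measurable M"
  shows "(\<lambda>w. ridge_solve l I (x w) (g w)) \<in> borel_measurable M"
proof -
  define A :: "'w \<Rightarrow> real^'d^'d" where "A w = matrix (ridge_op l I (x w))" for w
  have A: "A w *v v = ridge_op l I (x w) v" for w v
    unfolding A_def by (rule matrix_vector_mul(2)[OF linear_ridge_op, THEN fun_cong])
  have nz: "det (A w) \<noteq> 0" for w
    unfolding A_def det_nz_iff_inj[OF linear_ridge_op] by (rule bij_is_inj[OF bij_ridge_op[OF l]])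
  have cramer: "ridge_solve l I (x w) (g w)
      = (\<chi> k. det (\<chi> i j. if j = k then g w $ i else A w $ i $ j) / det (A w))" for w
    using cramer[OF nz, of w "ridge_solve l I (x w) (g w)" "g w"] l by (simp add: A)
  have [measurable]: "(\<lambda>w. A w $ i $ j) \<in> borel_measurable M" for i j
    using measurable_compose[OF ridge_op_measurable borel_measurable_vec_nth, of I x M "\<lambda>_. axis j 1" l i] x
    by (simp add: A_def matrix_def)
  have [measurable]: "(\<lambda>w. if j = k then g w $ i else A w $ i $ j) \<in> borel_measurable M" for i j k
    using measurable_compose[OF g borel_measurable_vec_nth] by (cases "j = k") auto
  have [measurable]: "(\<lambda>w. det (A w)) \<in> borel_measurable M"
    "(\<lambda>w. det (\<chi> i j. if j = k then g w $ i else A w $ i $ j)) \<in> borel_measurable M" for k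
    by (auto intro!: borel_measurable_det)
  show ?thesis
    unfolding cramer by (subst borel_measurable_euclidean_space) (auto simp: Basis_vec_def inner_axis)
qed

lemma leverage_measurable:
  fixes x :: "'w \<Rightarrow> 'i \<Rightarrow> real^'d"
  assumes "0 < l" and x[measurable]: "\<And>i. i \<in> I \<Longrightarrow> (\<lambda>w. x w i) \<in> borel_measurable M" and "k \<in> I"
  shows "(\<lambda>w. leverage l I (x w) k) \<in> borel_measurable M"
  unfolding leverage_def using assms by (intro borel_measurable_inner ridge_solve_measurable) auto

text \<open>The determinant turns spanning into a measurable condition on \<open>x\<close>. The additional fixed vectors \<open>W\<close>
  allow the design points to be drawn one at a time.\<close>

lemma span_eq_UNIV_iff_det:
  fixes x :: "'i \<Rightarrow> real^'d"
  assumes "finite W" "finite I"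
  shows "span (W \<union> x ` I) = UNIV \<longleftrightarrow> det (matrix (\<lambda>v. ridge_op 0 W id v + ridge_op 0 I x v)) \<noteq> 0"
proof -
  let ?f = "\<lambda>v. ridge_op 0 W id v + ridge_op 0 I x v"
  have lin: "linear ?f" by (intro linear_compose_add linear_ridge_op)
  have "?f v = 0 \<longleftrightarrow> (\<forall>s\<in>W \<union> x ` I. s \<bullet> v = 0)" for v
  proof
    assume "?f v = 0"
    then have "v \<bullet> ridge_op 0 W id v + v \<bullet> ridge_op 0 I x v = 0"
      by (metis inner_add_right inner_zero_right)
    then have "(\<Sum>w\<in>W. (w \<bullet> v)\<^sup>2) + (\<Sum>i\<in>I. (x i \<bullet> v)\<^sup>2) = 0"
      by (simp add: ridge_op_quadratic)
    then show "\<forall>s\<in>W \<union> x ` I. s \<bullet> v = 0"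
      using assms by (subst (asm) add_nonneg_eq_0_iff) (auto simp: sum_nonneg sum_nonneg_eq_0_iff)
  qed (auto simp: ridge_op_def)
  then show ?thesis
    unfolding span_eq_UNIV_iff_orthogonal det_nz_iff_inj[OF lin] linear_injective_0[OF lin] by simp
qed

section \<open>Gaussian product measures\<close>

lemma sets_gaussian [measurable_cong, simp]: "sets (gaussian \<mu> \<sigma>) = sets borel"
  by (simp add: gaussian_def)

lemma space_gaussian [simp]: "space (gaussian \<mu> \<sigma>) = UNIV"
  by (simp add: gaussian_def)

lemma prob_space_gaussian: "0 < \<sigma> \<Longrightarrow> prob_space (gaussian \<mu> \<sigma>)"
  unfolding gaussian_def by (rule prob_space_normal_density)

lemma gaussian_shift: "0 < \<sigma> \<Longrightarrow> distr (gaussian 0 \<sigma>) borel ((+) a) = gaussian a \<sigma>"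
proof (rule measure_eqI)
  fix A assume "A \<in> sets (distr (gaussian 0 \<sigma>) borel ((+) a))"
  then have [measurable]: "A \<in> sets borel" by simp
  have "emeasure (gaussian a \<sigma>) A
      = (\<integral>\<^sup>+t. ennreal (normal_density a \<sigma> (a + 1 * t)) * indicator A (a + 1 * t) \<partial>lborel)"
    unfolding gaussian_def by (simp add: emeasure_density)
      (subst nn_integral_real_affine[where c = 1 and t = a], simp_all)
  also have "\<dots> = (\<integral>\<^sup>+t. ennreal (normal_density 0 \<sigma> t) * indicator ((+) a -` A) t \<partial>lborel)"
    by (intro nn_integral_cong) (simp add: normal_density_def indicator_def)
  also have "\<dots> = emeasure (distr (gaussian 0 \<sigma>) borel ((+) a)) A"
    using measurable_sets_borel[of "(+) a" borel A]
    by (simp add: emeasure_distr gaussian_def emeasure_density)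
  finally show "emeasure (distr (gaussian 0 \<sigma>) borel ((+) a)) A = emeasure (gaussian a \<sigma>) A" ..
qed simp

lemma gaussian_second_moment:
  assumes "0 < \<sigma>"
  shows "(\<integral>\<^sup>+e. ennreal ((c * e + b)\<^sup>2) \<partial>gaussian 0 \<sigma>) = ennreal (\<sigma>\<^sup>2 * c\<^sup>2 + b\<^sup>2)"
proof -
  let ?N = "normal_density 0 \<sigma>"
  have 2: "has_bochner_integral lborel (\<lambda>x. ?N x * x\<^sup>2) (\<sigma>\<^sup>2)"
    using normal_moment_even[OF assms, of 0 1] by (simp add: fact_numeral)
  have 1: "has_bochner_integral lborel (\<lambda>x. ?N x * x) 0"
    using normal_moment_odd[OF assms, of 0 0] by simp
  have 0: "has_bochner_integral lborel ?N 1"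
    using normal_moment_even[OF assms, of 0 0] by simp
  have "has_bochner_integral lborel (\<lambda>x. c\<^sup>2 * (?N x * x\<^sup>2) + 2 * c * b * (?N x * x) + b\<^sup>2 * ?N x)
      (c\<^sup>2 * \<sigma>\<^sup>2 + 2 * c * b * 0 + b\<^sup>2 * 1)"
    by (intro has_bochner_integral_add has_bochner_integral_mult_right 0 1 2)
  also have "(\<lambda>x. c\<^sup>2 * (?N x * x\<^sup>2) + 2 * c * b * (?N x * x) + b\<^sup>2 * ?N x) = (\<lambda>x. ?N x * (c * x + b)\<^sup>2)"
    by (auto simp: power2_eq_square algebra_simps)
  finally have *: "has_bochner_integral lborel (\<lambda>x. ?N x * (c * x + b)\<^sup>2) (\<sigma>\<^sup>2 * c\<^sup>2 + b\<^sup>2)"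
    by (simp add: mult.commute)
  have "(\<integral>\<^sup>+e. ennreal ((c * e + b)\<^sup>2) \<partial>gaussian 0 \<sigma>) = (\<integral>\<^sup>+e. ennreal (?N e * (c * e + b)\<^sup>2) \<partial>lborel)"
    unfolding gaussian_def by (subst nn_integral_density) (simp_all add: ennreal_mult)
  also have "\<dots> = ennreal (\<sigma>\<^sup>2 * c\<^sup>2 + b\<^sup>2)"
    using * by (subst nn_integral_eq_integral) (auto simp: has_bochner_integral_iff)
  finally show ?thesis .
qed

text \<open>Only orthogonality of independent centred variables is behind this formula. An induction that integrates
  one coordinate at a time, with the offset \<open>b\<close> absorbing it, stays within nonnegative integrals and
  thus avoids integrability conditions.\<close>

lemma gaussian_product_second_moment:
  assumes "0 < \<sigma>" "finite I"
  shows "(\<integral>\<^sup>+e. ennreal (((\<Sum>i\<in>I. c i * e i) + b)\<^sup>2) \<partial>(\<Pi>\<^sub>M i\<in>I. gaussian 0 \<sigma>))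
    = ennreal (\<sigma>\<^sup>2 * (\<Sum>i\<in>I. (c i)\<^sup>2) + b\<^sup>2)"
  using assms(2)
proof (induction I arbitrary: b rule: finite_induct)
  case empty
  then show ?case by (simp add: PiM_empty nn_integral_count_space_finite)
next
  case (insert j I)
  interpret prob_space "gaussian 0 \<sigma>" using assms by (intro prob_space_gaussian)
  interpret product_sigma_finite "\<lambda>_. gaussian 0 \<sigma>" ..
  have "(\<integral>\<^sup>+e. ennreal (((\<Sum>i\<in>insert j I. c i * e i) + b)\<^sup>2) \<partial>(\<Pi>\<^sub>M i\<in>insert j I. gaussian 0 \<sigma>))
      = (\<integral>\<^sup>+y. \<integral>\<^sup>+e. ennreal (((\<Sum>i\<in>insert j I. c i * (e(j := y)) i) + b)\<^sup>2)
            \<partial>(\<Pi>\<^sub>M i\<in>I. gaussian 0 \<sigma>) \<partial>gaussian 0 \<sigma>)"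
    using insert by (intro product_nn_integral_insert_rev) auto
  also have "\<dots> = (\<integral>\<^sup>+y. \<integral>\<^sup>+e. ennreal (((\<Sum>i\<in>I. c i * e i) + (c j * y + b))\<^sup>2)
            \<partial>(\<Pi>\<^sub>M i\<in>I. gaussian 0 \<sigma>) \<partial>gaussian 0 \<sigma>)"
  proof -
    have "(\<Sum>i\<in>I. c i * (e(j := y)) i) = (\<Sum>i\<in>I. c i * e i)" for e y
      using insert by (intro sum.cong) auto
    then show ?thesis using insert by (simp add: ac_simps)
  qed
  also have "\<dots> = (\<integral>\<^sup>+y. ennreal (\<sigma>\<^sup>2 * (\<Sum>i\<in>I. (c i)\<^sup>2)) + ennreal ((c j * y + b)\<^sup>2) \<partial>gaussian 0 \<sigma>)"
    by (simp add: insert.IH ennreal_plus[symmetric] sum_nonneg del: ennreal_plus)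
  also have "\<dots> = ennreal (\<sigma>\<^sup>2 * (\<Sum>i\<in>I. (c i)\<^sup>2)) + ennreal (\<sigma>\<^sup>2 * (c j)\<^sup>2 + b\<^sup>2)"
    using assms emeasure_space_1 by (subst nn_integral_add) (auto simp: gaussian_second_moment)
  also have "\<dots> = ennreal (\<sigma>\<^sup>2 * (\<Sum>i\<in>insert j I. (c i)\<^sup>2) + b\<^sup>2)"
    using insert by (subst ennreal_plus[symmetric]) (auto simp: sum_nonneg algebra_simps)
  finally show ?case .
qed

lemma PiM_gaussian_eq_density:
  assumes "0 < \<sigma>" "finite I"
  shows "(\<Pi>\<^sub>M i\<in>I. gaussian (a i) \<sigma>)
    = density (\<Pi>\<^sub>M i\<in>I. lborel) (\<lambda>y. \<Prod>i\<in>I. ennreal (normal_density (a i) \<sigma> (y i)))"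
proof (rule product_sigma_finite.PiM_eqI[symmetric])
  show "product_sigma_finite (\<lambda>i. gaussian (a i) \<sigma>)"
    using assms by (intro product_sigma_finite.intro prob_space_imp_sigma_finite prob_space_gaussian)
  interpret product_sigma_finite "\<lambda>_. lborel :: real measure" ..
  show "sets (density (\<Pi>\<^sub>M i\<in>I. lborel) (\<lambda>y. \<Prod>i\<in>I. ennreal (normal_density (a i) \<sigma> (y i))))
      = sets (\<Pi>\<^sub>M i\<in>I. gaussian (a i) \<sigma>)"
    by (simp cong: sets_PiM_cong)
  fix A assume A: "\<And>i. i \<in> I \<Longrightarrow> A i \<in> sets (gaussian (a i) \<sigma>)"
  then have [measurable]: "i \<in> I \<Longrightarrow> A i \<in> sets borel" for i by simp
  have "emeasure (density (\<Pi>\<^sub>M i\<in>I. lborel) (\<lambda>y. \<Prod>i\<in>I. ennreal (normal_density (a i) \<sigma> (y i)))) (Pi\<^sub>E I A)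
      = (\<integral>\<^sup>+y. (\<Prod>i\<in>I. ennreal (normal_density (a i) \<sigma> (y i))) * indicator (Pi\<^sub>E I A) y \<partial>(\<Pi>\<^sub>M i\<in>I. lborel))"
    using assms by (intro emeasure_density) (auto intro!: sets_PiM_I_finite)
  also have "\<dots> = (\<integral>\<^sup>+y. (\<Prod>i\<in>I. ennreal (normal_density (a i) \<sigma> (y i)) * indicator (A i) (y i)) \<partial>(\<Pi>\<^sub>M i\<in>I. lborel))"
    using assms
    by (intro nn_integral_cong) (auto simp: prod.distrib indicator_def space_PiM PiE_iff prod_zero_iff
        prod.If_cases intro!: prod.neutral)
  also have "\<dots> = (\<Prod>i\<in>I. \<integral>\<^sup>+t. ennreal (normal_density (a i) \<sigma> t) * indicator (A i) t \<partial>lborel)"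
    using assms by (intro product_nn_integral_prod) auto
  also have "\<dots> = (\<Prod>i\<in>I. emeasure (gaussian (a i) \<sigma>) (A i))"
    by (intro prod.cong) (auto simp: gaussian_def emeasure_density)
  finally show "emeasure (density (\<Pi>\<^sub>M i\<in>I. lborel) (\<lambda>y. \<Prod>i\<in>I. ennreal (normal_density (a i) \<sigma> (y i)))) (Pi\<^sub>E I A)
      = (\<Prod>i\<in>I. emeasure (gaussian (a i) \<sigma>) (A i))" .
qed (use assms in simp)

lemma nn_integral_shifted_gaussian_product:
  assumes "0 < \<sigma>" "finite I" and f[measurable]: "f \<in> borel_measurable (\<Pi>\<^sub>M i\<in>I. borel)"
  shows "(\<integral>\<^sup>+e. f (\<lambda>i\<in>I. a i + e i) \<partial>(\<Pi>\<^sub>M i\<in>I. gaussian 0 \<sigma>))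
    = (\<integral>\<^sup>+y. (\<Prod>i\<in>I. ennreal (normal_density (a i) \<sigma> (y i))) * f y \<partial>(\<Pi>\<^sub>M i\<in>I. lborel))"
proof -
  have [measurable_cong]: "sets (\<Pi>\<^sub>M i\<in>I. (lborel :: real measure)) = sets (\<Pi>\<^sub>M i\<in>I. borel)"
    "sets (\<Pi>\<^sub>M i\<in>I. gaussian 0 \<sigma>) = sets (\<Pi>\<^sub>M i\<in>I. borel)"
    by (simp_all cong: sets_PiM_cong)
  have shift: "distr (\<Pi>\<^sub>M i\<in>I. gaussian 0 \<sigma>) (\<Pi>\<^sub>M i\<in>I. borel) (\<lambda>e. \<lambda>i\<in>I. a i + e i) = (\<Pi>\<^sub>M i\<in>I. gaussian (a i) \<sigma>)"
  proof (rule product_sigma_finite.PiM_eqI)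
    show "product_sigma_finite (\<lambda>i. gaussian (a i) \<sigma>)"
      using assms by (intro product_sigma_finite.intro prob_space_imp_sigma_finite prob_space_gaussian)
    interpret product_sigma_finite "\<lambda>_. gaussian 0 \<sigma>"
      using assms by (intro product_sigma_finite.intro prob_space_imp_sigma_finite prob_space_gaussian)
    show "sets (distr (\<Pi>\<^sub>M i\<in>I. gaussian 0 \<sigma>) (\<Pi>\<^sub>M i\<in>I. borel) (\<lambda>e. \<lambda>i\<in>I. a i + e i))
        = sets (\<Pi>\<^sub>M i\<in>I. gaussian (a i) \<sigma>)"
      by (simp cong: sets_PiM_cong)
    fix A assume "\<And>i. i \<in> I \<Longrightarrow> A i \<in> sets (gaussian (a i) \<sigma>)"
    then have [measurable]: "i \<in> I \<Longrightarrow> A i \<in> sets borel" for i by simp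
    have pre: "(+) (a i) -` A i \<in> sets borel" if "i \<in> I" for i
      using measurable_sets_borel[of "(+) (a i)" borel "A i"] that by simp
    have "emeasure (distr (\<Pi>\<^sub>M i\<in>I. gaussian 0 \<sigma>) (\<Pi>\<^sub>M i\<in>I. borel) (\<lambda>e. \<lambda>i\<in>I. a i + e i)) (Pi\<^sub>E I A)
        = emeasure (\<Pi>\<^sub>M i\<in>I. gaussian 0 \<sigma>) (\<Pi>\<^sub>E i\<in>I. (+) (a i) -` A i)"
      using assms by (subst emeasure_distr)
        (auto intro!: sets_PiM_I_finite arg_cong2[where f=emeasure] simp: space_PiM PiE_iff)
    also have "\<dots> = (\<Prod>i\<in>I. emeasure (gaussian 0 \<sigma>) ((+) (a i) -` A i))"
      using assms pre by (intro emeasure_PiM) auto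
    also have "\<dots> = (\<Prod>i\<in>I. emeasure (gaussian (a i) \<sigma>) (A i))"
    proof (intro prod.cong refl)
      fix i assume "i \<in> I"
      then show "emeasure (gaussian 0 \<sigma>) ((+) (a i) -` A i) = emeasure (gaussian (a i) \<sigma>) (A i)"
        unfolding gaussian_shift[OF assms(1), of "a i", symmetric] by (simp add: emeasure_distr)
    qed
    finally show "emeasure (distr (\<Pi>\<^sub>M i\<in>I. gaussian 0 \<sigma>) (\<Pi>\<^sub>M i\<in>I. borel) (\<lambda>e. \<lambda>i\<in>I. a i + e i)) (Pi\<^sub>E I A)
        = (\<Prod>i\<in>I. emeasure (gaussian (a i) \<sigma>) (A i))" .
  qed fact
  have "(\<integral>\<^sup>+e. f (\<lambda>i\<in>I. a i + e i) \<partial>(\<Pi>\<^sub>M i\<in>I. gaussian 0 \<sigma>)) = (\<integral>\<^sup>+y. f y \<partial>(\<Pi>\<^sub>M i\<in>I. gaussian (a i) \<sigma>))"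
    unfolding shift[symmetric] by (subst nn_integral_distr) auto
  then show ?thesis
    using assms by (simp add: PiM_gaussian_eq_density nn_integral_density)
qed

lemma nn_integral_lborel_point_reflection:
  fixes m :: "'a::euclidean_space"
  assumes [measurable]: "f \<in> borel_measurable borel"
  shows "(\<integral>\<^sup>+b. f b \<partial>lborel) = (\<integral>\<^sup>+b. f (2 *\<^sub>R m - b) \<partial>lborel)"
  by (subst lborel_affine[of "-1" "2 *\<^sub>R m"]) (simp_all add: nn_integral_density nn_integral_distr)

text \<open>The centred normal distribution with covariance \<open>\<tau>\<^sup>2\<close> times the identity.\<close>

definition gaussian_prior :: "real \<Rightarrow> 'a::euclidean_space measure" where
  "gaussian_prior \<tau> = density lborel (\<lambda>\<beta>. \<Prod>b\<in>Basis. ennreal (normal_density 0 \<tau> (\<beta> \<bullet> b)))"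

lemma sets_gaussian_prior [measurable_cong, simp]: "sets (gaussian_prior \<tau>) = sets borel"
  by (simp add: gaussian_prior_def)

text \<open>Independence of the coordinates reduces moments of the prior to those of a product of normal
  distributions on the line.\<close>

lemma gaussian_prior_eq_distr:
  assumes "0 < \<tau>"
  shows "gaussian_prior \<tau> = distr (\<Pi>\<^sub>M b\<in>Basis. gaussian 0 \<tau>) borel (\<lambda>f. \<Sum>b\<in>Basis. f b *\<^sub>R (b::'a::euclidean_space))"
proof -
  let ?T = "\<lambda>f. \<Sum>b\<in>Basis. f b *\<^sub>R (b::'a)"
  have [measurable_cong]: "sets (\<Pi>\<^sub>M b\<in>(Basis::'a set). (lborel :: real measure)) = sets (\<Pi>\<^sub>M b\<in>Basis. borel)"
    by (simp cong: sets_PiM_cong)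
  have "gaussian_prior \<tau> = density (distr (\<Pi>\<^sub>M b\<in>Basis. lborel) borel ?T)
      (\<lambda>\<beta>. \<Prod>b\<in>Basis. ennreal (normal_density 0 \<tau> (\<beta> \<bullet> b)))"
    unfolding gaussian_prior_def by (subst lborel_eq) simp
  also have "\<dots> = distr (density (\<Pi>\<^sub>M b\<in>Basis. lborel)
      (\<lambda>f. \<Prod>b\<in>Basis. ennreal (normal_density 0 \<tau> (?T f \<bullet> b)))) borel ?T"
    by (intro density_distr) auto
  also have "(\<lambda>f. \<Prod>b\<in>Basis. ennreal (normal_density 0 \<tau> (?T f \<bullet> b)))
      = (\<lambda>f. \<Prod>b\<in>Basis. ennreal (normal_density 0 \<tau> (f b)))"
    by (intro ext prod.cong) (auto simp: inner_sum_left inner_Basis if_distrib sum.delta cong: if_cong)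
  finally show ?thesis
    using PiM_gaussian_eq_density[OF assms, of "Basis :: 'a set" "\<lambda>_. 0"] by simp
qed

lemma prob_space_gaussian_prior: "0 < \<tau> \<Longrightarrow> prob_space (gaussian_prior \<tau>)"
  unfolding gaussian_prior_eq_distr
  by (intro prob_space.prob_space_distr prob_space_PiM prob_space_gaussian) auto

lemma gaussian_prior_second_moment:
  fixes u :: "'a::euclidean_space"
  assumes "0 < \<tau>"
  shows "(\<integral>\<^sup>+\<beta>. ennreal ((\<beta> \<bullet> u)\<^sup>2) \<partial>gaussian_prior \<tau>) = ennreal (\<tau>\<^sup>2 * (u \<bullet> u))"
proof -
  have "(\<integral>\<^sup>+\<beta>. ennreal ((\<beta> \<bullet> u)\<^sup>2) \<partial>gaussian_prior \<tau>)
      = (\<integral>\<^sup>+f. ennreal (((\<Sum>b\<in>Basis. (u \<bullet> b) * f b) + 0)\<^sup>2) \<partial>(\<Pi>\<^sub>M b\<in>(Basis::'a set). gaussian 0 \<tau>))"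
    unfolding gaussian_prior_eq_distr[OF assms]
    by (subst nn_integral_distr) (simp_all add: inner_sum_right inner_commute[of _ u] mult.commute)
  also have "\<dots> = ennreal (\<tau>\<^sup>2 * (\<Sum>b\<in>Basis. (u \<bullet> b)\<^sup>2))"
    using assms by (subst gaussian_product_second_moment) auto
  also have "(\<Sum>b\<in>Basis. (u \<bullet> b)\<^sup>2) = u \<bullet> u"
    by (subst euclidean_inner) (simp add: power2_eq_square)
  finally show ?thesis .
qed

lemma prod_normal_density:
  "(\<Prod>i\<in>I. normal_density (a i) s (y i))
    = (1 / sqrt (2 * pi * s\<^sup>2)) ^ card I * exp (- (\<Sum>i\<in>I. (y i - a i)\<^sup>2) / (2 * s\<^sup>2))"
proof (cases "finite I")
  case True
  show ?thesis
    unfolding normal_density_def prod.distrib prod_constant exp_sum[OF True, symmetric]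
    by (simp only: sum_divide_distrib sum_negf[symmetric])
qed simp

text \<open>Up to a constant factor, the joint density of \<open>\<beta>\<close> and the observations depends on them only through
  the objective of ridge regression with penalty \<open>\<sigma>\<^sup>2 / \<tau>\<^sup>2\<close>.\<close>

lemma gaussian_posterior_weight:
  fixes x :: "'i \<Rightarrow> 'a::euclidean_space"
  assumes "0 < \<sigma>" "0 < \<tau>"
  shows "\<exists>C. \<forall>\<beta> y. (\<Prod>b\<in>Basis. ennreal (normal_density 0 \<tau> (\<beta> \<bullet> b)))
        * (\<Prod>i\<in>I. ennreal (normal_density (\<beta> \<bullet> x i) \<sigma> (y i)))
      = ennreal (C * exp (- (\<sigma>\<^sup>2 / \<tau>\<^sup>2 * (\<beta> \<bullet> \<beta>) + (\<Sum>i\<in>I. (y i - \<beta> \<bullet> x i)\<^sup>2)) / (2 * \<sigma>\<^sup>2)))"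
proof (intro exI allI)
  fix \<beta> :: 'a and y :: "'i \<Rightarrow> real"
  let ?c = "\<lambda>s. 1 / sqrt (2 * pi * s\<^sup>2) :: real"
  have "(\<Sum>b\<in>Basis. (\<beta> \<bullet> b)\<^sup>2) = \<beta> \<bullet> \<beta>"
    by (subst euclidean_inner) (simp add: power2_eq_square)
  then have p1: "(\<Prod>b\<in>Basis. normal_density 0 \<tau> (\<beta> \<bullet> b))
      = ?c \<tau> ^ DIM('a) * exp (- (\<beta> \<bullet> \<beta>) / (2 * \<tau>\<^sup>2))"
    by (simp add: prod_normal_density)
  have p2: "(\<Prod>i\<in>I. normal_density (\<beta> \<bullet> x i) \<sigma> (y i))
      = ?c \<sigma> ^ card I * exp (- (\<Sum>i\<in>I. (y i - \<beta> \<bullet> x i)\<^sup>2) / (2 * \<sigma>\<^sup>2))"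
    by (rule prod_normal_density)
  have e: "exp (- (\<beta> \<bullet> \<beta>) / (2 * \<tau>\<^sup>2)) * exp (- (\<Sum>i\<in>I. (y i - \<beta> \<bullet> x i)\<^sup>2) / (2 * \<sigma>\<^sup>2))
      = exp (- (\<sigma>\<^sup>2 / \<tau>\<^sup>2 * (\<beta> \<bullet> \<beta>) + (\<Sum>i\<in>I. (y i - \<beta> \<bullet> x i)\<^sup>2)) / (2 * \<sigma>\<^sup>2))"
    using assms unfolding exp_add[symmetric] by (simp add: field_simps)
  have "(\<Prod>b\<in>Basis. normal_density 0 \<tau> (\<beta> \<bullet> b)) * (\<Prod>i\<in>I. normal_density (\<beta> \<bullet> x i) \<sigma> (y i))
      = ?c \<tau> ^ DIM('a) * ?c \<sigma> ^ card I * exp (- (\<sigma>\<^sup>2 / \<tau>\<^sup>2 * (\<beta> \<bullet> \<beta>) + (\<Sum>i\<in>I. (y i - \<beta> \<bullet> x i)\<^sup>2)) / (2 * \<sigma>\<^sup>2))"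
    unfolding p1 p2 e[symmetric] by (simp only: mult_ac)
  then have "ennreal ((\<Prod>b\<in>Basis. normal_density 0 \<tau> (\<beta> \<bullet> b)) * (\<Prod>i\<in>I. normal_density (\<beta> \<bullet> x i) \<sigma> (y i)))
      = ennreal (?c \<tau> ^ DIM('a) * ?c \<sigma> ^ card I
        * exp (- (\<sigma>\<^sup>2 / \<tau>\<^sup>2 * (\<beta> \<bullet> \<beta>) + (\<Sum>i\<in>I. (y i - \<beta> \<bullet> x i)\<^sup>2)) / (2 * \<sigma>\<^sup>2)))"
    by (rule arg_cong)
  then show "(\<Prod>b\<in>Basis. ennreal (normal_density 0 \<tau> (\<beta> \<bullet> b)))
        * (\<Prod>i\<in>I. ennreal (normal_density (\<beta> \<bullet> x i) \<sigma> (y i)))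
      = ennreal (?c \<tau> ^ DIM('a) * ?c \<sigma> ^ card I
        * exp (- (\<sigma>\<^sup>2 / \<tau>\<^sup>2 * (\<beta> \<bullet> \<beta>) + (\<Sum>i\<in>I. (y i - \<beta> \<bullet> x i)\<^sup>2)) / (2 * \<sigma>\<^sup>2)))"
    by (subst (1 2) prod_ennreal) (auto simp only: ennreal_mult prod_nonneg normal_density_nonneg)
qed

section \<open>Bayes risk for a fixed design\<close>

text \<open>The objective is a quadratic function with stationary point \<open>m\<close>, hence symmetric about \<open>m\<close>.\<close>

lemma ridge_objective_reflection:
  assumes m: "ridge_op l I x m = (\<Sum>i\<in>I. y i *\<^sub>R x i)"
  defines "Q \<equiv> \<lambda>\<beta>. l * (\<beta> \<bullet> \<beta>) + (\<Sum>i\<in>I. (y i - \<beta> \<bullet> x i)\<^sup>2)"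
  shows "Q (2 *\<^sub>R m - \<beta>) = Q \<beta>"
proof -
  let ?A = "ridge_op l I x"
  have Q: "Q v = v \<bullet> ?A v - 2 * (v \<bullet> ?A m) + (\<Sum>i\<in>I. (y i)\<^sup>2)" for v
  proof -
    have "(\<Sum>i\<in>I. (y i - v \<bullet> x i)\<^sup>2) = (\<Sum>i\<in>I. (y i)\<^sup>2 + (x i \<bullet> v)\<^sup>2 - 2 * (y i * (v \<bullet> x i)))"
      by (intro sum.cong refl) (simp add: power2_diff inner_commute)
    also have "\<dots> = (\<Sum>i\<in>I. (y i)\<^sup>2) + (\<Sum>i\<in>I. (x i \<bullet> v)\<^sup>2) - 2 * (v \<bullet> ?A m)"
      by (simp add: m sum.distrib sum_subtractf inner_sum_right sum_distrib_left)
    finally show ?thesis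
      unfolding Q_def ridge_op_quadratic by simp
  qed
  have A: "?A (2 *\<^sub>R m - \<beta>) = 2 *\<^sub>R ?A m - ?A \<beta>"
    using linear_ridge_op[of l I x] by (simp add: linear_diff linear_scale)
  have "m \<bullet> ?A \<beta> = \<beta> \<bullet> ?A m"
    by (metis ridge_op_symmetric inner_commute)
  then show ?thesis
    unfolding Q A by (simp add: inner_diff_left inner_diff_right)
qed

text \<open>For fixed observations the posterior of \<open>\<beta>\<close> is symmetric about the ridge estimate \<open>m\<close>. Averaging the
  squared error of a guess \<open>c\<close> of \<open>\<langle>\<beta>, z\<rangle>\<close> over \<open>\<beta>\<close> and its mirror image \<open>2 m - \<beta>\<close> gives the squared
  error of \<open>\<langle>m, z\<rangle>\<close> plus \<open>(c - \<langle>m, z\<rangle>)\<^sup>2\<close>, so no estimator beats \<open>m\<close>. The left-hand side is the risk of \<open>m\<close>: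
  with \<open>u\<close> the ridge solution for \<open>z\<close>, the error of \<open>\<langle>m, z\<rangle>\<close> is the sum of \<open>e\<^sub>i \<langle>x\<^sub>i, u\<rangle>\<close> minus
  \<open>l \<langle>\<beta>, u\<rangle>\<close>, a combination of independent centred normal variables.\<close>

lemma bayes_risk_fixed_design:
  fixes x :: "'i \<Rightarrow> 'a::euclidean_space"
  assumes \<sigma>: "0 < \<sigma>" and \<tau>: "0 < \<tau>" and I: "finite I"
    and bh[measurable]: "bh \<in> borel_measurable (\<Pi>\<^sub>M i\<in>I. borel)"
  shows "ennreal (\<sigma>\<^sup>2 * (ridge_solve (\<sigma>\<^sup>2 / \<tau>\<^sup>2) I x z \<bullet> z))
    \<le> (\<integral>\<^sup>+\<beta>. \<integral>\<^sup>+e. ennreal ((bh (\<lambda>i\<in>I. \<beta> \<bullet> x i + e i) - \<beta> \<bullet> z)\<^sup>2) \<partial>(\<Pi>\<^sub>M i\<in>I. gaussian 0 \<sigma>) \<partial>gaussian_prior \<tau>)"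
proof -
  define l where "l = \<sigma>\<^sup>2 / \<tau>\<^sup>2"
  define u where "u = ridge_solve l I x z"
  have l: "0 < l" using \<sigma> \<tau> by (simp add: l_def)
  have u: "ridge_op l I x u = z" using l by (simp add: u_def)
  define w where "w \<beta> y = (\<Prod>b\<in>Basis. ennreal (normal_density 0 \<tau> (\<beta> \<bullet> b)))
        * (\<Prod>i\<in>I. ennreal (normal_density (\<beta> \<bullet> x i) \<sigma> (y i)))" for \<beta> :: 'a and y
  \<comment> \<open>The ridge prediction at \<open>z\<close>.\<close>
  define \<mu> where "\<mu> y = (\<Sum>i\<in>I. (x i \<bullet> u) * y i)" for y
  have [measurable_cong]: "sets (\<Pi>\<^sub>M i\<in>I. (lborel :: real measure)) = sets (\<Pi>\<^sub>M i\<in>I. borel)"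
    by (simp cong: sets_PiM_cong)
  have [measurable]: "(\<lambda>(\<beta>, y). w \<beta> y) \<in> borel_measurable (borel \<Otimes>\<^sub>M (\<Pi>\<^sub>M i\<in>I. borel))"
    unfolding w_def normal_density_def by measurable
  have [measurable]: "\<mu> \<in> borel_measurable (\<Pi>\<^sub>M i\<in>I. borel)"
    unfolding \<mu>_def by measurable
  interpret P: product_sigma_finite "\<lambda>_::'i. lborel :: real measure" ..
  interpret Y: sigma_finite_measure "\<Pi>\<^sub>M i\<in>I. (lborel :: real measure)"
    using I by (rule P.sigma_finite)
  interpret pair_sigma_finite "lborel :: 'a measure" "\<Pi>\<^sub>M i\<in>I. (lborel :: real measure)" ..
  \<comment> \<open>Fubini: the risk is an integral over the observations of an unnormalized posterior risk.\<close>
  have joint: "(\<integral>\<^sup>+\<beta>. \<integral>\<^sup>+e. ennreal ((f (\<lambda>i\<in>I. \<beta> \<bullet> x i + e i) - \<beta> \<bullet> z)\<^sup>2) \<partial>(\<Pi>\<^sub>M i\<in>I. gaussian 0 \<sigma>) \<partial>gaussian_prior \<tau>)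
      = (\<integral>\<^sup>+y. \<integral>\<^sup>+\<beta>. w \<beta> y * ennreal ((f y - \<beta> \<bullet> z)\<^sup>2) \<partial>lborel \<partial>(\<Pi>\<^sub>M i\<in>I. lborel))"
    if [measurable]: "f \<in> borel_measurable (\<Pi>\<^sub>M i\<in>I. borel)" for f
  proof -
    have "(\<integral>\<^sup>+\<beta>. \<integral>\<^sup>+e. ennreal ((f (\<lambda>i\<in>I. \<beta> \<bullet> x i + e i) - \<beta> \<bullet> z)\<^sup>2) \<partial>(\<Pi>\<^sub>M i\<in>I. gaussian 0 \<sigma>) \<partial>gaussian_prior \<tau>)
      = (\<integral>\<^sup>+\<beta>. \<integral>\<^sup>+y. (\<Prod>i\<in>I. ennreal (normal_density (\<beta> \<bullet> x i) \<sigma> (y i))) * ennreal ((f y - \<beta> \<bullet> z)\<^sup>2)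
          \<partial>(\<Pi>\<^sub>M i\<in>I. lborel) \<partial>gaussian_prior \<tau>)"
      using \<sigma> I by (intro nn_integral_cong nn_integral_shifted_gaussian_product) auto
    also have "\<dots> = (\<integral>\<^sup>+\<beta>. (\<Prod>b\<in>Basis. ennreal (normal_density 0 \<tau> (\<beta> \<bullet> b)))
          * (\<integral>\<^sup>+y. (\<Prod>i\<in>I. ennreal (normal_density (\<beta> \<bullet> x i) \<sigma> (y i))) * ennreal ((f y - \<beta> \<bullet> z)\<^sup>2)
          \<partial>(\<Pi>\<^sub>M i\<in>I. lborel)) \<partial>lborel)"
      unfolding gaussian_prior_def normal_density_def by (subst nn_integral_density) (measurable; simp)+
    also have "\<dots> = (\<integral>\<^sup>+\<beta>. \<integral>\<^sup>+y. w \<beta> y * ennreal ((f y - \<beta> \<bullet> z)\<^sup>2) \<partial>(\<Pi>\<^sub>M i\<in>I. lborel) \<partial>lborel)"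
      unfolding w_def mult.assoc
      by (intro nn_integral_cong nn_integral_cmult[symmetric]) measurable
    also have "\<dots> = (\<integral>\<^sup>+y. \<integral>\<^sup>+\<beta>. w \<beta> y * ennreal ((f y - \<beta> \<bullet> z)\<^sup>2) \<partial>lborel \<partial>(\<Pi>\<^sub>M i\<in>I. lborel))"
      by (rule Fubini'[symmetric]) measurable
    finally show ?thesis .
  qed
  have pointwise: "(\<integral>\<^sup>+\<beta>. w \<beta> y * ennreal ((\<mu> y - \<beta> \<bullet> z)\<^sup>2) \<partial>lborel)
      \<le> (\<integral>\<^sup>+\<beta>. w \<beta> y * ennreal ((c - \<beta> \<bullet> z)\<^sup>2) \<partial>lborel)" for y c
  proof -
    have [measurable]: "(\<lambda>\<beta>. w \<beta> y) \<in> borel_measurable borel"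
      unfolding w_def normal_density_def by measurable
    define m where "m = ridge_solve l I x (\<Sum>i\<in>I. y i *\<^sub>R x i)"
    have m: "ridge_op l I x m = (\<Sum>i\<in>I. y i *\<^sub>R x i)" using l by (simp add: m_def)
    have "m \<bullet> z = u \<bullet> ridge_op l I x m"
      using u by (simp add: ridge_op_symmetric inner_commute)
    then have mz: "m \<bullet> z = \<mu> y" by (simp add: m \<mu>_def inner_sum_right inner_commute mult.commute)
    obtain C where C: "\<And>\<beta>. w \<beta> y
        = ennreal (C * exp (- (l * (\<beta> \<bullet> \<beta>) + (\<Sum>i\<in>I. (y i - \<beta> \<bullet> x i)\<^sup>2)) / (2 * \<sigma>\<^sup>2)))"
      using gaussian_posterior_weight[OF \<sigma> \<tau>, where I=I and x=x] unfolding w_def l_def by blast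
    have w: "w (2 *\<^sub>R m - \<beta>) y = w \<beta> y" for \<beta>
      unfolding C ridge_objective_reflection[OF m] ..
    have "2 * (\<integral>\<^sup>+\<beta>. w \<beta> y * ennreal ((\<mu> y - \<beta> \<bullet> z)\<^sup>2) \<partial>lborel)
        = (\<integral>\<^sup>+\<beta>. w \<beta> y * ennreal (2 * (\<mu> y - \<beta> \<bullet> z)\<^sup>2) \<partial>lborel)"
      by (subst nn_integral_cmult[symmetric]) (auto simp: ennreal_mult ac_simps)
    also have "\<dots> \<le> (\<integral>\<^sup>+\<beta>. w \<beta> y * ennreal ((c - \<beta> \<bullet> z)\<^sup>2) + w \<beta> y * ennreal ((c - (2 *\<^sub>R m - \<beta>) \<bullet> z)\<^sup>2) \<partial>lborel)"
    proof (rule nn_integral_mono)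
      fix \<beta>
      have "(c - \<beta> \<bullet> z)\<^sup>2 + (c - (2 *\<^sub>R m - \<beta>) \<bullet> z)\<^sup>2 = 2 * (\<mu> y - \<beta> \<bullet> z)\<^sup>2 + 2 * (c - \<mu> y)\<^sup>2"
        by (simp add: mz inner_diff_left power2_eq_square algebra_simps)
      then have "2 * (\<mu> y - \<beta> \<bullet> z)\<^sup>2 \<le> (c - \<beta> \<bullet> z)\<^sup>2 + (c - (2 *\<^sub>R m - \<beta>) \<bullet> z)\<^sup>2"
        by simp
      then show "w \<beta> y * ennreal (2 * (\<mu> y - \<beta> \<bullet> z)\<^sup>2)
          \<le> w \<beta> y * ennreal ((c - \<beta> \<bullet> z)\<^sup>2) + w \<beta> y * ennreal ((c - (2 *\<^sub>R m - \<beta>) \<bullet> z)\<^sup>2)"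
        by (simp add: distrib_left[symmetric] ennreal_plus[symmetric] mult_left_mono ennreal_leI del: ennreal_plus)
    qed
    also have "\<dots> = (\<integral>\<^sup>+\<beta>. w \<beta> y * ennreal ((c - \<beta> \<bullet> z)\<^sup>2) \<partial>lborel)
        + (\<integral>\<^sup>+\<beta>. w (2 *\<^sub>R m - \<beta>) y * ennreal ((c - (2 *\<^sub>R m - \<beta>) \<bullet> z)\<^sup>2) \<partial>lborel)"
      unfolding w by (rule nn_integral_add) measurable
    also have "\<dots> = 2 * (\<integral>\<^sup>+\<beta>. w \<beta> y * ennreal ((c - \<beta> \<bullet> z)\<^sup>2) \<partial>lborel)"
      using nn_integral_lborel_point_reflection[of "\<lambda>\<beta>. w \<beta> y * ennreal ((c - \<beta> \<bullet> z)\<^sup>2)" m]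
      by (simp add: mult_2)
    finally show ?thesis
      by (simp add: ennreal_mult_le_mult_iff)
  qed
  have "\<sigma>\<^sup>2 * (u \<bullet> z) = \<sigma>\<^sup>2 * (\<Sum>i\<in>I. (x i \<bullet> u)\<^sup>2) + l\<^sup>2 * (\<tau>\<^sup>2 * (u \<bullet> u))"
  proof -
    have "u \<bullet> z = l * (u \<bullet> u) + (\<Sum>i\<in>I. (x i \<bullet> u)\<^sup>2)"
      using ridge_op_quadratic[of u l I x] by (simp add: u)
    moreover have "l * \<tau>\<^sup>2 = \<sigma>\<^sup>2" using \<tau> by (simp add: l_def)
    then have "l\<^sup>2 * (\<tau>\<^sup>2 * (u \<bullet> u)) = \<sigma>\<^sup>2 * (l * (u \<bullet> u))"
      by (metis mult.assoc mult.commute power2_eq_square)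
    ultimately show ?thesis by (simp only: distrib_left add.commute)
  qed
  then have "ennreal (\<sigma>\<^sup>2 * (u \<bullet> z)) = ennreal (\<sigma>\<^sup>2 * (\<Sum>i\<in>I. (x i \<bullet> u)\<^sup>2)) + ennreal (l\<^sup>2) * ennreal (\<tau>\<^sup>2 * (u \<bullet> u))"
    by (simp add: ennreal_mult[symmetric] ennreal_plus[symmetric] sum_nonneg del: ennreal_plus)
  also have "\<dots> = (\<integral>\<^sup>+\<beta>. ennreal (\<sigma>\<^sup>2 * (\<Sum>i\<in>I. (x i \<bullet> u)\<^sup>2)) + ennreal (l\<^sup>2) * ennreal ((\<beta> \<bullet> u)\<^sup>2) \<partial>gaussian_prior \<tau>)"
    using prob_space.emeasure_space_1[OF prob_space_gaussian_prior[OF \<tau>, where ?'a='a]]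
    by (simp add: nn_integral_add nn_integral_cmult gaussian_prior_second_moment[OF \<tau>])
  also have "\<dots> = (\<integral>\<^sup>+\<beta>. \<integral>\<^sup>+e. ennreal ((\<mu> (\<lambda>i\<in>I. \<beta> \<bullet> x i + e i) - \<beta> \<bullet> z)\<^sup>2) \<partial>(\<Pi>\<^sub>M i\<in>I. gaussian 0 \<sigma>) \<partial>gaussian_prior \<tau>)"
  proof (rule nn_integral_cong)
    fix \<beta>
    have "(\<Sum>i\<in>I. (x i \<bullet> u) * (\<beta> \<bullet> x i)) - \<beta> \<bullet> z = - (l * (\<beta> \<bullet> u))"
      unfolding u[symmetric] inner_ridge_op by (simp add: inner_commute mult.commute)
    then have "\<mu> (\<lambda>i\<in>I. \<beta> \<bullet> x i + e i) - \<beta> \<bullet> z = (\<Sum>i\<in>I. (x i \<bullet> u) * e i) + - (l * (\<beta> \<bullet> u))" for e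
      by (simp add: \<mu>_def distrib_left sum.distrib)
    then have "(\<integral>\<^sup>+e. ennreal ((\<mu> (\<lambda>i\<in>I. \<beta> \<bullet> x i + e i) - \<beta> \<bullet> z)\<^sup>2) \<partial>(\<Pi>\<^sub>M i\<in>I. gaussian 0 \<sigma>))
      = ennreal (\<sigma>\<^sup>2 * (\<Sum>i\<in>I. (x i \<bullet> u)\<^sup>2) + (- (l * (\<beta> \<bullet> u)))\<^sup>2)"
      using \<sigma> I by (simp only: gaussian_product_second_moment)
    then show "ennreal (\<sigma>\<^sup>2 * (\<Sum>i\<in>I. (x i \<bullet> u)\<^sup>2)) + ennreal (l\<^sup>2) * ennreal ((\<beta> \<bullet> u)\<^sup>2)
      = (\<integral>\<^sup>+e. ennreal ((\<mu> (\<lambda>i\<in>I. \<beta> \<bullet> x i + e i) - \<beta> \<bullet> z)\<^sup>2) \<partial>(\<Pi>\<^sub>M i\<in>I. gaussian 0 \<sigma>))"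
      by (simp add: ennreal_mult[symmetric] ennreal_plus[symmetric] sum_nonneg power_mult_distrib del: ennreal_plus)
  qed
  also have "\<dots> = (\<integral>\<^sup>+y. \<integral>\<^sup>+\<beta>. w \<beta> y * ennreal ((\<mu> y - \<beta> \<bullet> z)\<^sup>2) \<partial>lborel \<partial>(\<Pi>\<^sub>M i\<in>I. lborel))"
    by (rule joint) measurable
  also have "\<dots> \<le> (\<integral>\<^sup>+y. \<integral>\<^sup>+\<beta>. w \<beta> y * ennreal ((bh y - \<beta> \<bullet> z)\<^sup>2) \<partial>lborel \<partial>(\<Pi>\<^sub>M i\<in>I. lborel))"
    by (intro nn_integral_mono pointwise)
  also have "\<dots> = (\<integral>\<^sup>+\<beta>. \<integral>\<^sup>+e. ennreal ((bh (\<lambda>i\<in>I. \<beta> \<bullet> x i + e i) - \<beta> \<bullet> z)\<^sup>2) \<partial>(\<Pi>\<^sub>M i\<in>I. gaussian 0 \<sigma>) \<partial>gaussian_prior \<tau>)"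
    by (rule joint[symmetric]) measurable
  finally show ?thesis by (simp add: u_def l_def)
qed

section \<open>The linear Gaussian model with random design\<close>

text \<open>A sample of pairs is a pair of samples. This lets the design be fixed before the noise is integrated.\<close>

lemma PiM_distr_pair:
  assumes I: "finite I" and M: "prob_space M" and N: "prob_space N"
    and f[measurable]: "f \<in> M \<Otimes>\<^sub>M N \<rightarrow>\<^sub>M L"
  shows "(\<Pi>\<^sub>M i\<in>I. distr (M \<Otimes>\<^sub>M N) L f)
    = distr ((\<Pi>\<^sub>M i\<in>I. M) \<Otimes>\<^sub>M (\<Pi>\<^sub>M i\<in>I. N)) (\<Pi>\<^sub>M i\<in>I. L) (\<lambda>(x, e). \<lambda>i\<in>I. f (x i, e i))"
proof (rule product_sigma_finite.PiM_eqI[symmetric])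
  interpret M: prob_space M by fact
  interpret N: prob_space N by fact
  interpret MN: pair_prob_space M N ..
  interpret PM: product_sigma_finite "\<lambda>_. M" ..
  interpret PN: product_sigma_finite "\<lambda>_. N" ..
  interpret PN': prob_space "\<Pi>\<^sub>M i\<in>I. N" by (intro prob_space_PiM N)
  have "prob_space (distr (M \<Otimes>\<^sub>M N) L f)" by (intro MN.prob_space_distr f)
  then show "product_sigma_finite (\<lambda>i. distr (M \<Otimes>\<^sub>M N) L f)"
    by (intro product_sigma_finite.intro prob_space_imp_sigma_finite)
  show "sets (distr ((\<Pi>\<^sub>M i\<in>I. M) \<Otimes>\<^sub>M (\<Pi>\<^sub>M i\<in>I. N)) (\<Pi>\<^sub>M i\<in>I. L) (\<lambda>(x, e). \<lambda>i\<in>I. f (x i, e i)))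
      = sets (\<Pi>\<^sub>M i\<in>I. distr (M \<Otimes>\<^sub>M N) L f)"
    by (simp cong: sets_PiM_cong)
  have [measurable]: "(\<lambda>(x, e). \<lambda>i\<in>I. f (x i, e i)) \<in> (\<Pi>\<^sub>M i\<in>I. M) \<Otimes>\<^sub>M (\<Pi>\<^sub>M i\<in>I. N) \<rightarrow>\<^sub>M (\<Pi>\<^sub>M i\<in>I. L)"
    by measurable
  fix A assume "\<And>i. i \<in> I \<Longrightarrow> A i \<in> sets (distr (M \<Otimes>\<^sub>M N) L f)"
  then have A[measurable]: "i \<in> I \<Longrightarrow> A i \<in> sets L" for i by simp
  have box: "Pi\<^sub>E I A \<in> sets (\<Pi>\<^sub>M i\<in>I. L)"
    using I A by (rule sets_PiM_I_finite)
  have "emeasure (distr ((\<Pi>\<^sub>M i\<in>I. M) \<Otimes>\<^sub>M (\<Pi>\<^sub>M i\<in>I. N)) (\<Pi>\<^sub>M i\<in>I. L) (\<lambda>(x, e). \<lambda>i\<in>I. f (x i, e i))) (Pi\<^sub>E I A)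
      = (\<integral>\<^sup>+w. indicator (Pi\<^sub>E I A) w \<partial>distr ((\<Pi>\<^sub>M i\<in>I. M) \<Otimes>\<^sub>M (\<Pi>\<^sub>M i\<in>I. N)) (\<Pi>\<^sub>M i\<in>I. L) (\<lambda>(x, e). \<lambda>i\<in>I. f (x i, e i)))"
    using box by simp
  also have "\<dots> = (\<integral>\<^sup>+z. indicator (Pi\<^sub>E I A) (\<lambda>i\<in>I. f (fst z i, snd z i)) \<partial>((\<Pi>\<^sub>M i\<in>I. M) \<Otimes>\<^sub>M (\<Pi>\<^sub>M i\<in>I. N)))"
    using box by (subst nn_integral_distr) (simp_all add: case_prod_beta)
  also have "\<dots> = (\<integral>\<^sup>+z. (\<Prod>i\<in>I. indicator (A i) (f (fst z i, snd z i))) \<partial>((\<Pi>\<^sub>M i\<in>I. M) \<Otimes>\<^sub>M (\<Pi>\<^sub>M i\<in>I. N)))"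
    using I by (intro nn_integral_cong) (auto simp: indicator_def PiE_iff prod_zero_iff prod.neutral)
  also have "\<dots> = (\<integral>\<^sup>+x. \<integral>\<^sup>+e. (\<Prod>i\<in>I. indicator (A i) (f (x i, e i))) \<partial>(\<Pi>\<^sub>M i\<in>I. N) \<partial>(\<Pi>\<^sub>M i\<in>I. M))"
    by (subst PN'.nn_integral_fst[symmetric]) simp_all
  also have "\<dots> = (\<integral>\<^sup>+x. (\<Prod>i\<in>I. \<integral>\<^sup>+e. indicator (A i) (f (x i, e)) \<partial>N) \<partial>(\<Pi>\<^sub>M i\<in>I. M))"
    using I by (intro nn_integral_cong PN.product_nn_integral_prod) (auto simp: space_PiM PiE_iff)
  also have "\<dots> = (\<Prod>i\<in>I. \<integral>\<^sup>+x. \<integral>\<^sup>+e. indicator (A i) (f (x, e)) \<partial>N \<partial>M)"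
    using I by (intro PM.product_nn_integral_prod) auto
  also have "\<dots> = (\<Prod>i\<in>I. emeasure (distr (M \<Otimes>\<^sub>M N) L f) (A i))"
  proof (intro prod.cong refl)
    fix i assume i: "i \<in> I"
    note [measurable] = A[OF i]
    have "(\<integral>\<^sup>+x. \<integral>\<^sup>+e. indicator (A i) (f (x, e)) \<partial>N \<partial>M) = (\<integral>\<^sup>+z. indicator (A i) (f z) \<partial>(M \<Otimes>\<^sub>M N))"
      by (subst N.nn_integral_fst[symmetric]) simp_all
    also have "\<dots> = (\<integral>\<^sup>+w. indicator (A i) w \<partial>distr (M \<Otimes>\<^sub>M N) L f)"
      by (subst nn_integral_distr) simp_all
    finally show "(\<integral>\<^sup>+x. \<integral>\<^sup>+e. indicator (A i) (f (x, e)) \<partial>N \<partial>M) = emeasure (distr (M \<Otimes>\<^sub>M N) L f) (A i)"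
      by simp
  qed
  finally show "emeasure (distr ((\<Pi>\<^sub>M i\<in>I. M) \<Otimes>\<^sub>M (\<Pi>\<^sub>M i\<in>I. N)) (\<Pi>\<^sub>M i\<in>I. L) (\<lambda>(x, e). \<lambda>i\<in>I. f (x i, e i))) (Pi\<^sub>E I A)
      = (\<Prod>i\<in>I. emeasure (distr (M \<Otimes>\<^sub>M N) L f) (A i))" .
qed fact

definition linear_gaussian_model :: "(real^'d) measure \<Rightarrow> real \<Rightarrow> real^'d \<Rightarrow> ((real^'d) \<times> real) measure" where
  "linear_gaussian_model PX \<sigma> \<beta> = distr (PX \<Otimes>\<^sub>M gaussian 0 \<sigma>) borel (\<lambda>(x, e). (x, \<beta> \<bullet> x + e))"

locale random_design =
  fixes PX :: "(real^'d) measure" and \<sigma> :: real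
  assumes prob_PX: "prob_space PX" and sets_PX [measurable_cong, simp]: "sets PX = sets borel"
    and \<sigma>: "0 < \<sigma>"
begin

sublocale X: prob_space PX by (rule prob_PX)
sublocale noise: prob_space "gaussian 0 \<sigma>" using \<sigma> by (rule prob_space_gaussian)
sublocale X_noise: pair_prob_space PX "gaussian 0 \<sigma>" ..

lemma space_PX [simp]: "space PX = UNIV"
  using sets_eq_imp_space_eq[OF sets_PX] by simp

lemma measurable_model_map [measurable]:
  "(\<lambda>(x, e). (x, \<beta> \<bullet> x + e)) \<in> PX \<Otimes>\<^sub>M gaussian 0 \<sigma> \<rightarrow>\<^sub>M (borel :: ((real^'d) \<times> real) measure)"
  unfolding borel_prod[symmetric] by measurable

lemma nn_integral_model:
  assumes [measurable]: "f \<in> borel_measurable (borel :: ((real^'d) \<times> real) measure)"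
  shows "(\<integral>\<^sup>+z. f z \<partial>linear_gaussian_model PX \<sigma> \<beta>) = (\<integral>\<^sup>+x. \<integral>\<^sup>+e. f (x, \<beta> \<bullet> x + e) \<partial>gaussian 0 \<sigma> \<partial>PX)"
proof -
  have "(\<integral>\<^sup>+z. f z \<partial>linear_gaussian_model PX \<sigma> \<beta>) = (\<integral>\<^sup>+z. f (fst z, \<beta> \<bullet> fst z + snd z) \<partial>(PX \<Otimes>\<^sub>M gaussian 0 \<sigma>))"
    unfolding linear_gaussian_model_def by (subst nn_integral_distr) (simp_all add: case_prod_beta)
  also have "\<dots> = (\<integral>\<^sup>+x. \<integral>\<^sup>+e. f (x, \<beta> \<bullet> x + e) \<partial>gaussian 0 \<sigma> \<partial>PX)"
    using measurable_compose[OF measurable_model_map[of \<beta>] assms]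
    by (subst noise.nn_integral_fst[symmetric]) (simp_all add: case_prod_beta)
  finally show ?thesis .
qed

lemma model_in_gauss_class: "linear_gaussian_model PX \<sigma> \<beta> \<in> gauss_class PX \<sigma>"
proof -
  let ?P = "linear_gaussian_model PX \<sigma> \<beta>"
  have s: "sets ?P = sets borel" by (simp add: linear_gaussian_model_def)
  have sp: "space ?P = UNIV" by (simp add: linear_gaussian_model_def)
  have m1: "fst \<in> borel_measurable (borel :: ((real^'d) \<times> real) measure)"
    unfolding borel_prod[symmetric] by measurable
  have m2: "(\<lambda>(x, y). y - \<beta> \<bullet> x) \<in> borel_measurable (borel :: ((real^'d) \<times> real) measure)"
    unfolding borel_prod[symmetric] by measurable
  have "prob_space ?P"
    unfolding linear_gaussian_model_def by (intro X_noise.prob_space_distr measurable_model_map)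
  moreover have "distr ?P borel fst = PX"
  proof (rule measure_eqI)
    fix A assume "A \<in> sets (distr ?P borel fst)"
    then have A[measurable]: "A \<in> sets borel" by simp
    have "emeasure (distr ?P borel fst) A = (\<integral>\<^sup>+w. indicator A w \<partial>distr ?P borel fst)"
      by simp
    also have "\<dots> = (\<integral>\<^sup>+z. indicator A (fst z) \<partial>?P)"
      using m1 s by (subst nn_integral_distr) (auto cong: measurable_cong_sets)
    also have "\<dots> = (\<integral>\<^sup>+x. \<integral>\<^sup>+e. indicator A x \<partial>gaussian 0 \<sigma> \<partial>PX)"
      using m1 by (subst nn_integral_model) auto
    also have "\<dots> = emeasure PX A"
      using noise.emeasure_space_1 by simp
    finally show "emeasure (distr ?P borel fst) A = emeasure PX A" .
  qed simp
  moreover have "has_cond_distr ?P fst (\<lambda>(x, y). y - \<beta> \<bullet> x) (\<lambda>_. gaussian 0 \<sigma>)"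
    unfolding has_cond_distr_def
  proof (intro conjI ballI)
    show "fst \<in> borel_measurable ?P" "(\<lambda>(x, y). y - \<beta> \<bullet> x) \<in> borel_measurable ?P"
      using m1 m2 s by (simp_all cong: measurable_cong_sets)
    show "(\<lambda>_. gaussian 0 \<sigma>) \<in> borel \<rightarrow>\<^sub>M prob_algebra borel"
      by (intro measurable_const) (simp add: space_prob_algebra noise.prob_space_axioms)
    fix A :: "(real^'d) set" and B :: "real set"
    assume [measurable]: "A \<in> sets borel" "B \<in> sets borel"
    let ?S = "{w. fst w \<in> A \<and> (case w of (x, y) \<Rightarrow> y - \<beta> \<bullet> x) \<in> B}"
    have "?S = fst -` A \<inter> (\<lambda>(x, y). y - \<beta> \<bullet> x) -` B" by auto
    then have S: "?S \<in> sets (borel :: ((real^'d) \<times> real) measure)"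
      using measurable_sets_borel[OF m1, of A] measurable_sets_borel[OF m2, of B] by (simp add: sets.Int)
    have "emeasure ?P {w \<in> space ?P. fst w \<in> A \<and> (case w of (x, y) \<Rightarrow> y - \<beta> \<bullet> x) \<in> B}
        = (\<integral>\<^sup>+z. indicator ?S z \<partial>?P)"
      using S s sp by simp
    also have "\<dots> = (\<integral>\<^sup>+x. \<integral>\<^sup>+e. indicator ?S (x, \<beta> \<bullet> x + e) \<partial>gaussian 0 \<sigma> \<partial>PX)"
      using S by (intro nn_integral_model) simp
    also have "\<dots> = (\<integral>\<^sup>+x. \<integral>\<^sup>+e. indicator A x * indicator B e \<partial>gaussian 0 \<sigma> \<partial>PX)"
      by (intro nn_integral_cong) (auto simp: indicator_def)
    also have "\<dots> = (\<integral>\<^sup>+x. \<integral>\<^sup>+e. indicator A (fst (x, \<beta> \<bullet> x + e)) * emeasure (gaussian 0 \<sigma>) B \<partial>gaussian 0 \<sigma> \<partial>PX)"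
      using noise.emeasure_space_1 by (simp add: nn_integral_cmult)
    also have "\<dots> = (\<integral>\<^sup>+w. indicator A (fst w) * emeasure (gaussian 0 \<sigma>) B \<partial>?P)"
      using m1 by (intro nn_integral_model[symmetric]) simp
    finally show "emeasure ?P {w \<in> space ?P. fst w \<in> A \<and> (case w of (x, y) \<Rightarrow> y - \<beta> \<bullet> x) \<in> B}
        = (\<integral>\<^sup>+w. indicator A (fst w) * emeasure (gaussian 0 \<sigma>) B \<partial>?P)" .
  qed
  ultimately show ?thesis
    using s by (auto simp: gauss_class_def)
qed

lemma integrable_inner_square:
  assumes "integrable PX (\<lambda>x. (norm x)\<^sup>2)"
  shows "integrable PX (\<lambda>x. (v \<bullet> x)\<^sup>2)"
proof (rule Bochner_Integration.integrable_bound)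
  show "integrable PX (\<lambda>x. (norm v)\<^sup>2 * (norm x)\<^sup>2)" using assms by simp
  show "AE x in PX. norm ((v \<bullet> x)\<^sup>2) \<le> norm ((norm v)\<^sup>2 * (norm x)\<^sup>2)"
  proof (rule AE_I2)
    fix x
    have "(v \<bullet> x)\<^sup>2 \<le> (norm v * norm x)\<^sup>2"
      using Cauchy_Schwarz_ineq2[of v x] by (simp add: abs_le_square_iff[symmetric] abs_mult)
    then show "norm ((v \<bullet> x)\<^sup>2) \<le> norm ((norm v)\<^sup>2 * (norm x)\<^sup>2)" by (simp add: power_mult_distrib)
  qed
qed measurable

lemma risk_model:
  assumes "integrable PX (\<lambda>x. (norm x)\<^sup>2)"
  shows "risk (linear_gaussian_model PX \<sigma> \<beta>) b = \<sigma>\<^sup>2 + (\<integral>x. ((b - \<beta>) \<bullet> x)\<^sup>2 \<partial>PX)"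
proof -
  let ?P = "linear_gaussian_model PX \<sigma> \<beta>"
  have m: "(\<lambda>(x, y). (y - b \<bullet> x)\<^sup>2) \<in> borel_measurable (borel :: ((real^'d) \<times> real) measure)"
    unfolding borel_prod[symmetric] by measurable
  note int = integrable_inner_square[OF assms, of "b - \<beta>"]
  have "(\<integral>\<^sup>+z. ennreal (case z of (x, y) \<Rightarrow> (y - b \<bullet> x)\<^sup>2) \<partial>?P)
      = (\<integral>\<^sup>+x. \<integral>\<^sup>+e. ennreal ((1 * e + - ((b - \<beta>) \<bullet> x))\<^sup>2) \<partial>gaussian 0 \<sigma> \<partial>PX)"
    using m by (subst nn_integral_model) (auto simp: inner_diff_left algebra_simps)
  also have "\<dots> = (\<integral>\<^sup>+x. ennreal (\<sigma>\<^sup>2 + ((b - \<beta>) \<bullet> x)\<^sup>2) \<partial>PX)"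
    unfolding gaussian_second_moment[OF \<sigma>] by simp
  also have "\<dots> = ennreal (\<sigma>\<^sup>2 + (\<integral>x. ((b - \<beta>) \<bullet> x)\<^sup>2 \<partial>PX))"
    using int X.prob_space by (subst nn_integral_eq_integral) auto
  finally have "(\<integral>\<^sup>+z. ennreal (case z of (x, y) \<Rightarrow> (y - b \<bullet> x)\<^sup>2) \<partial>?P)
      = ennreal (\<sigma>\<^sup>2 + (\<integral>x. ((b - \<beta>) \<bullet> x)\<^sup>2 \<partial>PX))" .
  moreover have "risk ?P b = enn2real (\<integral>\<^sup>+z. ennreal (case z of (x, y) \<Rightarrow> (y - b \<bullet> x)\<^sup>2) \<partial>?P)"
    unfolding risk_def using m
    by (intro integral_eq_nn_integral) (auto simp: linear_gaussian_model_def)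
  ultimately show ?thesis by (simp del: ennreal_plus)
qed

lemma AE_inner_nonzero:
  assumes "\<not> degenerate PX" "v \<noteq> 0"
  shows "AE x in PX. v \<bullet> x \<noteq> 0"
proof -
  have "measure PX {x \<in> space PX. (v /\<^sub>R norm v) \<bullet> x = 0} = 0"
    using assms unfolding degenerate_def by (auto simp: not_less measure_le_0_iff dest!: spec[of _ "v /\<^sub>R norm v"])
  then have "emeasure PX {x \<in> space PX. v \<bullet> x = 0} = 0"
    using assms by (simp add: X.emeasure_eq_measure)
  then show ?thesis
    by (subst AE_iff_measurable[OF _ refl]) auto
qed

text \<open>Non-degeneracy makes \<open>\<beta>\<close> the only minimizer of the risk, so the excess risk is the mean squared
  difference of the two predictions at a fresh covariate.\<close>

lemma excess_risk_model:
  assumes int: "integrable PX (\<lambda>x. (norm x)\<^sup>2)" and nd: "\<not> degenerate PX"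
  shows "ennreal (excess_risk (linear_gaussian_model PX \<sigma> \<beta>) b) = (\<integral>\<^sup>+x. ennreal ((b \<bullet> x - \<beta> \<bullet> x)\<^sup>2) \<partial>PX)"
proof -
  let ?P = "linear_gaussian_model PX \<sigma> \<beta>"
  define V where "V v = (\<integral>x. (v \<bullet> x)\<^sup>2 \<partial>PX)" for v
  have V: "V v > 0" if "v \<noteq> 0" for v
  proof -
    have "V v \<noteq> 0"
    proof
      assume "V v = 0"
      then have "AE x in PX. (v \<bullet> x)\<^sup>2 = 0"
        unfolding V_def using integral_nonneg_eq_0_iff_AE[OF integrable_inner_square[OF int]] by simp
      with AE_inner_nonzero[OF nd that] have "AE x in PX. False" by eventually_elim simp
      then show False by simp
    qed
    then show ?thesis unfolding V_def by (simp add: less_le)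
  qed
  have V0: "V 0 = 0" by (simp add: V_def)
  have risk: "risk ?P c = \<sigma>\<^sup>2 + V (c - \<beta>)" for c
    unfolding V_def by (rule risk_model[OF int])
  have "is_arg_min (risk ?P) (\<lambda>_. True) c \<longleftrightarrow> c = \<beta>" for c
    unfolding is_arg_min_def risk using V V0 by (metis add_less_cancel_left diff_self eq_iff_diff_eq_0 not_less_iff_gr_or_eq)
  then have "risk_minimizer ?P = \<beta>" by (simp add: risk_minimizer_def)
  then have "excess_risk ?P b = V (b - \<beta>)" by (simp add: excess_risk_def risk V0)
  also have "ennreal (V (b - \<beta>)) = (\<integral>\<^sup>+x. ennreal (((b - \<beta>) \<bullet> x)\<^sup>2) \<partial>PX)"
    unfolding V_def using integrable_inner_square[OF int] by (subst nn_integral_eq_integral) auto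
  finally show ?thesis by (simp add: inner_diff_left)
qed

text \<open>The fresh covariate of the excess risk is adjoined to the design as its point of index \<open>n\<close>, which
  puts all covariates on an equal footing.\<close>

lemma expected_excess_risk_model:
  assumes int: "integrable PX (\<lambda>x. (norm x)\<^sup>2)" and nd: "\<not> degenerate PX"
    and bh: "bhat \<in> estimators n"
  shows "expected_excess_risk n (linear_gaussian_model PX \<sigma> \<beta>) bhat
    = (\<integral>\<^sup>+\<xi>. \<integral>\<^sup>+e. ennreal ((bhat (\<lambda>i\<in>{..<n}. (\<xi> i, \<beta> \<bullet> \<xi> i + e i)) \<bullet> \<xi> n - \<beta> \<bullet> \<xi> n)\<^sup>2)
        \<partial>(\<Pi>\<^sub>M i\<in>{..<n}. gaussian 0 \<sigma>) \<partial>(\<Pi>\<^sub>M i\<in>{..<Suc n}. PX))"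
proof -
  let ?P = "linear_gaussian_model PX \<sigma> \<beta>"
  let ?S = "\<Pi>\<^sub>M i\<in>{..<n}. (borel :: ((real^'d) \<times> real) measure)"
  let ?X = "\<Pi>\<^sub>M i\<in>{..<n}. PX" and ?E = "\<Pi>\<^sub>M i\<in>{..<n}. gaussian 0 \<sigma>"
  define zip where "zip x e = (\<lambda>i\<in>{..<n}. (x i, \<beta> \<bullet> x i + e i))" for x :: "nat \<Rightarrow> real^'d" and e
  have bh_meas[measurable]: "bhat \<in> borel_measurable ?S" using bh by (simp add: estimators_def)
  interpret PX: product_sigma_finite "\<lambda>_::nat. PX" ..
  interpret E: prob_space ?E by (intro prob_space_PiM noise.prob_space_axioms)
  interpret XE: pair_sigma_finite PX ?E ..
  have zip_meas: "(\<lambda>z. zip (fst z) (snd z)) \<in> ?X \<Otimes>\<^sub>M ?E \<rightarrow>\<^sub>M ?S"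
    unfolding zip_def borel_prod[symmetric] by measurable
  have sample: "(\<Pi>\<^sub>M i\<in>{..<n}. ?P) = distr (?X \<Otimes>\<^sub>M ?E) ?S (\<lambda>z. zip (fst z) (snd z))"
    unfolding linear_gaussian_model_def zip_def
    by (subst PiM_distr_pair[OF _ X.prob_space_axioms noise.prob_space_axioms measurable_model_map])
      (simp_all add: case_prod_unfold)
  have est_meas: "(\<lambda>z. bhat (zip (fst z) (snd z))) \<in> borel_measurable (?X \<Otimes>\<^sub>M ?E)"
    by (rule measurable_compose[OF zip_meas bh_meas])
  have "expected_excess_risk n ?P bhat = (\<integral>\<^sup>+s. \<integral>\<^sup>+x'. ennreal ((bhat s \<bullet> x' - \<beta> \<bullet> x')\<^sup>2) \<partial>PX \<partial>(\<Pi>\<^sub>M i\<in>{..<n}. ?P))"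
    unfolding expected_excess_risk_def by (simp add: excess_risk_model[OF int nd])
  also have "\<dots> = (\<integral>\<^sup>+z. \<integral>\<^sup>+x'. ennreal ((bhat (zip (fst z) (snd z)) \<bullet> x' - \<beta> \<bullet> x')\<^sup>2) \<partial>PX \<partial>(?X \<Otimes>\<^sub>M ?E))"
    unfolding sample using zip_meas by (subst nn_integral_distr) simp_all
  also have "\<dots> = (\<integral>\<^sup>+x. \<integral>\<^sup>+e. \<integral>\<^sup>+x'. ennreal ((bhat (zip x e) \<bullet> x' - \<beta> \<bullet> x')\<^sup>2) \<partial>PX \<partial>?E \<partial>?X)"
    using est_meas by (subst E.nn_integral_fst[symmetric]) simp_all
  also have "\<dots> = (\<integral>\<^sup>+x. \<integral>\<^sup>+x'. \<integral>\<^sup>+e. ennreal ((bhat (zip x e) \<bullet> x' - \<beta> \<bullet> x')\<^sup>2) \<partial>?E \<partial>PX \<partial>?X)"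
  proof (intro nn_integral_cong XE.Fubini')
    fix x assume "x \<in> space ?X"
    then have "(\<lambda>e. bhat (zip x e)) \<in> borel_measurable ?E"
      using measurable_Pair2[OF est_meas] by simp
    then show "(\<lambda>(x', e). ennreal ((bhat (zip x e) \<bullet> x' - \<beta> \<bullet> x')\<^sup>2)) \<in> borel_measurable (PX \<Otimes>\<^sub>M ?E)"
      by simp
  qed
  also have "\<dots> = (\<integral>\<^sup>+x. \<integral>\<^sup>+x'. \<integral>\<^sup>+e. ennreal ((bhat (zip (x(n := x')) e) \<bullet> (x(n := x')) n - \<beta> \<bullet> (x(n := x')) n)\<^sup>2) \<partial>?E \<partial>PX \<partial>?X)"
  proof -
    have "zip (x(n := x')) e = zip x e" for x x' e by (auto simp: zip_def)
    then show ?thesis by simp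
  qed
  also have "\<dots> = (\<integral>\<^sup>+\<xi>. \<integral>\<^sup>+e. ennreal ((bhat (zip \<xi> e) \<bullet> \<xi> n - \<beta> \<bullet> \<xi> n)\<^sup>2) \<partial>?E \<partial>(\<Pi>\<^sub>M i\<in>insert n {..<n}. PX))"
  proof (rule PX.product_nn_integral_insert[symmetric])
    have "(\<lambda>z. zip (fst z) (snd z)) \<in> (\<Pi>\<^sub>M i\<in>insert n {..<n}. PX) \<Otimes>\<^sub>M ?E \<rightarrow>\<^sub>M ?S"
      unfolding zip_def borel_prod[symmetric] by measurable
    then have [measurable]: "(\<lambda>z. bhat (zip (fst z) (snd z))) \<in> borel_measurable ((\<Pi>\<^sub>M i\<in>insert n {..<n}. PX) \<Otimes>\<^sub>M ?E)"
      by (rule measurable_compose[OF _ bh_meas])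
    then have [measurable]: "(\<lambda>(\<xi>, e). bhat (zip \<xi> e)) \<in> borel_measurable ((\<Pi>\<^sub>M i\<in>insert n {..<n}. PX) \<Otimes>\<^sub>M ?E)"
      by (simp add: case_prod_beta)
    show "(\<lambda>\<xi>. \<integral>\<^sup>+e. ennreal ((bhat (zip \<xi> e) \<bullet> \<xi> n - \<beta> \<bullet> \<xi> n)\<^sup>2) \<partial>?E) \<in> borel_measurable (\<Pi>\<^sub>M i\<in>insert n {..<n}. PX)"
      by measurable
  qed simp_all
  finally show ?thesis by (simp add: zip_def lessThan_Suc)
qed

end

section \<open>Expected leverages\<close>

context random_design begin

text \<open>While \<open>W\<close> does not span, it lies in a hyperplane, which the next design point almost surely avoids, so
  the dimension increases. Generalizing over \<open>W\<close> lets the induction fix the first point drawn and treat the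
  others as random.\<close>

lemma AE_span_eq_UNIV:
  assumes nd: "\<not> degenerate PX"
  assumes "finite I" "finite W" "CARD('d) \<le> card I + dim W"
  shows "AE x in (\<Pi>\<^sub>M i\<in>I. PX). span (W \<union> x ` I) = UNIV"
  using assms(2-)
proof (induction I arbitrary: W rule: finite_induct)
  case (empty W)
  then have "dim W = DIM(real^'d)" using dim_subset_UNIV[of W] by simp
  then have "span W = UNIV" using dim_eq_full[of W] by simp
  then show ?case by simp
next
  case (insert k I W)
  interpret PX: product_sigma_finite "\<lambda>_. PX" ..
  let ?P = "\<lambda>x. span (W \<union> x ` insert k I) = UNIV"
  let ?B = "{x \<in> space (\<Pi>\<^sub>M i\<in>insert k I. PX). \<not> ?P x}"
  have comp: "(\<lambda>x. (ridge_op 0 W id v + ridge_op 0 (insert k I) x v) $ i) \<in> borel_measurable (\<Pi>\<^sub>M i\<in>insert k I. PX)" for v i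
    by (intro measurable_compose[OF _ borel_measurable_vec_nth] borel_measurable_add ridge_op_measurable)
      (auto intro: measurable_compose[OF measurable_component_singleton])
  have "(\<lambda>x. det (matrix (\<lambda>v. ridge_op 0 W id v + ridge_op 0 (insert k I) x v))) \<in> borel_measurable (\<Pi>\<^sub>M i\<in>insert k I. PX)"
    using comp by (intro borel_measurable_det) (simp add: matrix_def)
  then have B: "?B \<in> sets (\<Pi>\<^sub>M i\<in>insert k I. PX)"
    using insert by (subst span_eq_UNIV_iff_det) simp_all
  have step: "AE y in PX. CARD('d) \<le> card I + dim (insert y W)"
  proof (cases "span W = UNIV")
    case True
    then have "dim (insert y W) = DIM(real^'d)" for y
      by (metis dim_UNIV dim_span span_mono subset_insertI top.extremum_uniqueI)
    then show ?thesis by simp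
  next
    case False
    then obtain v where v: "v \<noteq> 0" "\<forall>s\<in>span W. v \<bullet> s = 0"
      using span_not_UNIV_orthogonal by blast
    from AE_inner_nonzero[OF nd v(1)] show ?thesis
    proof eventually_elim
      case (elim y)
      then have "y \<notin> span W" using v by auto
      then show ?case using insert by (simp add: dim_insert)
    qed
  qed
  have "emeasure (\<Pi>\<^sub>M i\<in>insert k I. PX) ?B = (\<integral>\<^sup>+x. indicator ?B x \<partial>(\<Pi>\<^sub>M i\<in>insert k I. PX))"
    using B by simp
  also have "\<dots> = (\<integral>\<^sup>+y. \<integral>\<^sup>+x. indicator ?B (x(k := y)) \<partial>(\<Pi>\<^sub>M i\<in>I. PX) \<partial>PX)"
    using insert B by (intro PX.product_nn_integral_insert_rev) auto
  also have "\<dots> = (\<integral>\<^sup>+y. 0 \<partial>PX)"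
  proof (rule nn_integral_cong_AE)
    from step show "AE y in PX. (\<integral>\<^sup>+x. indicator ?B (x(k := y)) \<partial>(\<Pi>\<^sub>M i\<in>I. PX)) = 0"
    proof eventually_elim
      case (elim y)
      have "AE x in (\<Pi>\<^sub>M i\<in>I. PX). span (insert y W \<union> x ` I) = UNIV"
        using insert elim by (intro insert.IH) auto
      then have "AE x in (\<Pi>\<^sub>M i\<in>I. PX). indicator ?B (x(k := y)) = (0::ennreal)"
      proof eventually_elim
        case (elim x)
        have "(x(k := y)) ` insert k I = insert y (x ` I)" using insert by auto
        with elim have "?P (x(k := y))" by (simp only: Un_insert_left Un_insert_right)
        then have "x(k := y) \<notin> ?B" by blast
        then show ?case by (rule indicator_simps(2))
      qed
      then have "(\<integral>\<^sup>+x. indicator ?B (x(k := y)) \<partial>(\<Pi>\<^sub>M i\<in>I. PX)) = (\<integral>\<^sup>+x. 0 \<partial>(\<Pi>\<^sub>M i\<in>I. PX))"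
        by (rule nn_integral_cong_AE)
      then show ?case by simp
    qed
  qed
  finally have "emeasure (\<Pi>\<^sub>M i\<in>insert k I. PX) ?B = 0" by simp
  then show ?case
    using B by (subst AE_iff_measurable[OF _ refl]) auto
qed

lemma integrable_leverage:
  assumes "0 < l" "finite I" "k \<in> I"
  shows "integrable (\<Pi>\<^sub>M i\<in>I. PX) (\<lambda>\<xi>. leverage l I \<xi> k)"
proof -
  interpret prob_space "\<Pi>\<^sub>M i\<in>I. PX" by (intro prob_space_PiM X.prob_space_axioms)
  show ?thesis
  proof (rule integrable_const_bound[where B = 1])
    show "(\<lambda>\<xi>. leverage l I \<xi> k) \<in> borel_measurable (\<Pi>\<^sub>M i\<in>I. PX)"
      using assms by (intro leverage_measurable) (auto intro: measurable_compose[OF measurable_component_singleton])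
    show "AE \<xi> in \<Pi>\<^sub>M i\<in>I. PX. norm (leverage l I \<xi> k) \<le> 1"
    proof (rule AE_I2)
      fix \<xi> :: "_ \<Rightarrow> real^'d"
      show "norm (leverage l I \<xi> k) \<le> 1" using leverage_bounds[OF assms, of \<xi>] by simp
    qed
  qed
qed

text \<open>Transposing two design points preserves the distribution of the design and exchanges their
  leverages.\<close>

lemma expectation_leverage_exchangeable:
  assumes l: "0 < l" and I: "finite I" and jk: "j \<in> I" "k \<in> I"
  shows "(\<integral>\<xi>. leverage l I \<xi> j \<partial>(\<Pi>\<^sub>M i\<in>I. PX)) = (\<integral>\<xi>. leverage l I \<xi> k \<partial>(\<Pi>\<^sub>M i\<in>I. PX))"
proof -
  let ?p = "Transposition.transpose j k"
  let ?M = "\<Pi>\<^sub>M i\<in>I. PX"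
  have p: "bij_betw ?p I I" using jk by (intro bij_betw_transpose_iff) auto
  have "distr ?M ?M (\<lambda>\<xi>. \<lambda>i\<in>I. \<xi> (?p i)) = ?M"
    using p by (intro distr_PiM_reindex X.prob_space_axioms) (auto simp: bij_betw_def)
  then have "(\<integral>\<xi>. leverage l I \<xi> j \<partial>?M) = (\<integral>\<xi>. leverage l I \<xi> j \<partial>distr ?M ?M (\<lambda>\<xi>. \<lambda>i\<in>I. \<xi> (?p i)))"
    by simp
  also have "\<dots> = (\<integral>\<xi>. leverage l I (\<lambda>i\<in>I. \<xi> (?p i)) j \<partial>?M)"
    using integrable_leverage[OF l I jk(1)] p
    by (intro integral_distr) (auto simp: bij_betw_def intro!: measurable_restrict measurable_component_singleton)
  also have "\<dots> = (\<integral>\<xi>. leverage l I \<xi> k \<partial>?M)"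
  proof (rule Bochner_Integration.integral_cong[OF refl])
    fix \<xi> :: "_ \<Rightarrow> real^'d"
    have "ridge_op l I (\<lambda>i\<in>I. \<xi> (?p i)) = ridge_op l I (\<lambda>i. \<xi> (?p i))" by (rule ridge_op_cong) simp
    then have "leverage l I (\<lambda>i\<in>I. \<xi> (?p i)) j = leverage l I (\<lambda>i. \<xi> (?p i)) j"
      using jk by (simp add: leverage_def ridge_solve_def)
    then show "leverage l I (\<lambda>i\<in>I. \<xi> (?p i)) j = leverage l I \<xi> k"
      by (simp add: leverage_permuted[OF p])
  qed
  finally show ?thesis .
qed

lemma expectation_leverage:
  assumes l: "0 < l" and I: "finite I" and k: "k \<in> I"
  shows "real (card I) * (\<integral>\<xi>. leverage l I \<xi> k \<partial>(\<Pi>\<^sub>M i\<in>I. PX))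
    = real CARD('d) - (\<integral>\<xi>. (\<Sum>b\<in>Basis. l * (ridge_solve l I \<xi> b \<bullet> b)) \<partial>(\<Pi>\<^sub>M i\<in>I. PX))"
proof -
  let ?M = "\<Pi>\<^sub>M i\<in>I. PX"
  interpret M: prob_space ?M by (intro prob_space_PiM X.prob_space_axioms)
  have "real (card I) * (\<integral>\<xi>. leverage l I \<xi> k \<partial>?M) = (\<Sum>i\<in>I. \<integral>\<xi>. leverage l I \<xi> i \<partial>?M)"
    using expectation_leverage_exchangeable[OF l I _ k] by simp
  also have "\<dots> = (\<integral>\<xi>. (\<Sum>i\<in>I. leverage l I \<xi> i) \<partial>?M)"
    using integrable_leverage[OF l I] by (intro Bochner_Integration.integral_sum[symmetric])
  finally have *: "real (card I) * (\<integral>\<xi>. leverage l I \<xi> k \<partial>?M) = (\<integral>\<xi>. (\<Sum>i\<in>I. leverage l I \<xi> i) \<partial>?M)" .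
  have "(\<integral>\<xi>. (\<Sum>b\<in>Basis. l * (ridge_solve l I \<xi> b \<bullet> b)) \<partial>?M)
      = (\<integral>\<xi>. real CARD('d) - (\<Sum>i\<in>I. leverage l I \<xi> i) \<partial>?M)"
    by (simp add: sum_leverage[OF l])
  also have "\<dots> = real CARD('d) - (\<integral>\<xi>. (\<Sum>i\<in>I. leverage l I \<xi> i) \<partial>?M)"
    using integrable_leverage[OF l I] M.prob_space
    by (subst Bochner_Integration.integral_diff) (auto intro!: Bochner_Integration.integrable_sum)
  finally show ?thesis unfolding * by simp
qed

text \<open>Almost every design spans, so the correction to the mean leverage vanishes in the limit; it is
  bounded by the dimension throughout.\<close>

lemma expectation_ridge_bias_tendsto_0:
  assumes nd: "\<not> degenerate PX" and I: "finite I" "CARD('d) \<le> card I"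
    and l: "\<And>n. 0 < l n" "l \<longlonglongrightarrow> 0"
  shows "(\<lambda>n. \<integral>\<xi>. (\<Sum>b\<in>Basis. l n * (ridge_solve (l n) I \<xi> b \<bullet> b)) \<partial>(\<Pi>\<^sub>M i\<in>I. PX)) \<longlonglongrightarrow> 0"
proof -
  let ?M = "\<Pi>\<^sub>M i\<in>I. PX"
  interpret M: prob_space ?M by (intro prob_space_PiM X.prob_space_axioms)
  let ?s = "\<lambda>n \<xi>. \<Sum>b\<in>(Basis::(real^'d) set). l n * (ridge_solve (l n) I \<xi> b \<bullet> b)"
  have "(\<lambda>n. \<integral>\<xi>. ?s n \<xi> \<partial>?M) \<longlonglongrightarrow> (\<integral>\<xi>. 0 \<partial>?M)"
  proof (rule integral_dominated_convergence[where w = "\<lambda>_. real CARD('d)"])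
    show "?s n \<in> borel_measurable ?M" for n
      using l by (intro borel_measurable_sum borel_measurable_times borel_measurable_inner ridge_solve_measurable)
        (auto intro: measurable_compose[OF measurable_component_singleton])
    have "AE \<xi> in ?M. span ({} \<union> \<xi> ` I) = UNIV"
      using I by (intro AE_span_eq_UNIV nd) auto
    then show "AE \<xi> in ?M. (\<lambda>n. ?s n \<xi>) \<longlonglongrightarrow> 0"
    proof eventually_elim
      case (elim \<xi>)
      then show ?case using l I by (intro tendsto_null_sum ridge_bias_tendsto_0) auto
    qed
    show "AE \<xi> in ?M. norm (?s n \<xi>) \<le> real CARD('d)" for n
    proof (rule AE_I2)
      fix \<xi>
      have "norm (?s n \<xi>) \<le> (\<Sum>b\<in>(Basis::(real^'d) set). 1)"
        using ridge_bias_bounds[OF l(1), where I=I and x=\<xi>] by (intro sum_norm_le) (simp add: abs_of_nonneg)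
      then show "norm (?s n \<xi>) \<le> real CARD('d)" by simp
    qed
  qed simp_all
  then show ?thesis by simp
qed

section \<open>The minimax lower bound\<close>

text \<open>The worst case is at least the average over the prior. After exchanging the order of integration, the
  bound for a fixed design applies to each design, with the point of index \<open>n\<close> as the point of
  prediction.\<close>

lemma worst_case_risk_ge_ridge_variance:
  assumes int: "integrable PX (\<lambda>x. (norm x)\<^sup>2)" and nd: "\<not> degenerate PX"
    and bh: "bhat \<in> estimators n" and \<tau>: "0 < \<tau>"
  shows "(\<integral>\<^sup>+\<xi>. ennreal (\<sigma>\<^sup>2 * (ridge_solve (\<sigma>\<^sup>2 / \<tau>\<^sup>2) {..<n} \<xi> (\<xi> n) \<bullet> \<xi> n)) \<partial>(\<Pi>\<^sub>M i\<in>{..<Suc n}. PX))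
    \<le> (SUP P\<in>gauss_class PX \<sigma>. expected_excess_risk n P bhat)"
proof -
  let ?D = "\<Pi>\<^sub>M i\<in>{..<Suc n}. PX" and ?E = "\<Pi>\<^sub>M i\<in>{..<n}. gaussian 0 \<sigma>"
  let ?\<pi> = "gaussian_prior \<tau> :: (real^'d) measure"
  let ?S = "\<Pi>\<^sub>M i\<in>{..<n}. (borel :: ((real^'d) \<times> real) measure)"
  let ?loss = "\<lambda>\<beta> \<xi> e. ennreal ((bhat (\<lambda>i\<in>{..<n}. (\<xi> i, \<beta> \<bullet> \<xi> i + e i)) \<bullet> \<xi> n - \<beta> \<bullet> \<xi> n)\<^sup>2)"
  have bh_meas: "bhat \<in> borel_measurable ?S" using bh by (simp add: estimators_def)
  interpret prior: prob_space ?\<pi> using \<tau> by (rule prob_space_gaussian_prior)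
  interpret D: prob_space ?D by (intro prob_space_PiM X.prob_space_axioms)
  interpret E: prob_space ?E by (intro prob_space_PiM noise.prob_space_axioms)
  interpret pair_sigma_finite ?D ?\<pi> ..
  have "(\<integral>\<^sup>+\<xi>. ennreal (\<sigma>\<^sup>2 * (ridge_solve (\<sigma>\<^sup>2 / \<tau>\<^sup>2) {..<n} \<xi> (\<xi> n) \<bullet> \<xi> n)) \<partial>?D)
      \<le> (\<integral>\<^sup>+\<xi>. \<integral>\<^sup>+\<beta>. \<integral>\<^sup>+e. ?loss \<beta> \<xi> e \<partial>?E \<partial>?\<pi> \<partial>?D)"
  proof (rule nn_integral_mono)
    fix \<xi> :: "nat \<Rightarrow> real^'d"
    let ?bh = "\<lambda>y. bhat (\<lambda>i\<in>{..<n}. (\<xi> i, y i)) \<bullet> \<xi> n"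
    have "(\<lambda>y. \<lambda>i\<in>{..<n}. (\<xi> i, y i)) \<in> (\<Pi>\<^sub>M i\<in>{..<n}. borel) \<rightarrow>\<^sub>M ?S"
      unfolding borel_prod[symmetric] by measurable
    from measurable_compose[OF this bh_meas]
    have "?bh \<in> borel_measurable (\<Pi>\<^sub>M i\<in>{..<n}. borel)" by simp
    from bayes_risk_fixed_design[OF \<sigma> \<tau> _ this, of \<xi> "\<xi> n"]
    have "ennreal (\<sigma>\<^sup>2 * (ridge_solve (\<sigma>\<^sup>2 / \<tau>\<^sup>2) {..<n} \<xi> (\<xi> n) \<bullet> \<xi> n))
      \<le> (\<integral>\<^sup>+\<beta>. \<integral>\<^sup>+e. ennreal ((?bh (\<lambda>i\<in>{..<n}. \<beta> \<bullet> \<xi> i + e i) - \<beta> \<bullet> \<xi> n)\<^sup>2) \<partial>?E \<partial>?\<pi>)"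
      by simp
    moreover have "(\<lambda>i\<in>{..<n}. (\<xi> i, (\<lambda>i\<in>{..<n}. \<beta> \<bullet> \<xi> i + e i) i)) = (\<lambda>i\<in>{..<n}. (\<xi> i, \<beta> \<bullet> \<xi> i + e i))" for \<beta> e
      by (rule restrict_ext) simp
    ultimately show "ennreal (\<sigma>\<^sup>2 * (ridge_solve (\<sigma>\<^sup>2 / \<tau>\<^sup>2) {..<n} \<xi> (\<xi> n) \<bullet> \<xi> n))
      \<le> (\<integral>\<^sup>+\<beta>. \<integral>\<^sup>+e. ?loss \<beta> \<xi> e \<partial>?E \<partial>?\<pi>)"
      by simp
  qed
  also have "\<dots> = (\<integral>\<^sup>+\<beta>. \<integral>\<^sup>+\<xi>. \<integral>\<^sup>+e. ?loss \<beta> \<xi> e \<partial>?E \<partial>?D \<partial>?\<pi>)"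
  proof (rule Fubini'[symmetric])
    have "(\<lambda>z. \<lambda>i\<in>{..<n}. (fst (fst z) i, snd (fst z) \<bullet> fst (fst z) i + snd z i)) \<in> (?D \<Otimes>\<^sub>M ?\<pi>) \<Otimes>\<^sub>M ?E \<rightarrow>\<^sub>M ?S"
      unfolding borel_prod[symmetric] by measurable
    from measurable_compose[OF this bh_meas]
    have [measurable]: "(\<lambda>z. bhat (\<lambda>i\<in>{..<n}. (fst (fst z) i, snd (fst z) \<bullet> fst (fst z) i + snd z i)))
        \<in> borel_measurable ((?D \<Otimes>\<^sub>M ?\<pi>) \<Otimes>\<^sub>M ?E)" .
    have "(\<lambda>z. \<integral>\<^sup>+e. ?loss (snd z) (fst z) e \<partial>?E) \<in> borel_measurable (?D \<Otimes>\<^sub>M ?\<pi>)"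
      by (rule E.borel_measurable_nn_integral) (simp add: case_prod_unfold)
    then show "(\<lambda>(\<xi>, \<beta>). \<integral>\<^sup>+e. ?loss \<beta> \<xi> e \<partial>?E) \<in> borel_measurable (?D \<Otimes>\<^sub>M ?\<pi>)"
      by (simp add: case_prod_unfold)
  qed
  also have "\<dots> = (\<integral>\<^sup>+\<beta>. expected_excess_risk n (linear_gaussian_model PX \<sigma> \<beta>) bhat \<partial>?\<pi>)"
    by (simp add: expected_excess_risk_model[OF int nd bh])
  also have "\<dots> \<le> (\<integral>\<^sup>+\<beta>. (SUP P\<in>gauss_class PX \<sigma>. expected_excess_risk n P bhat) \<partial>?\<pi>)"
    by (intro nn_integral_mono SUP_upper model_in_gauss_class)
  also have "\<dots> = (SUP P\<in>gauss_class PX \<sigma>. expected_excess_risk n P bhat)"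
    using prior.emeasure_space_1 by simp
  finally show ?thesis .
qed

text \<open>The tangent is taken at \<open>h0 = d / (n + 1)\<close>, the limit of the mean leverage, which among all tangents
  gives the largest bound as the prior becomes flat.\<close>

lemma worst_case_risk_lower_bound:
  assumes int: "integrable PX (\<lambda>x. (norm x)\<^sup>2)" and nd: "\<not> degenerate PX"
    and bh: "bhat \<in> estimators n" and n: "CARD('d) \<le> n"
  shows "ennreal (\<sigma>\<^sup>2 * real CARD('d) / (real n - real CARD('d) + 1))
    \<le> (SUP P\<in>gauss_class PX \<sigma>. expected_excess_risk n P bhat)" (is "_ \<le> ?R")
proof -
  let ?J = "{..<Suc n}"
  let ?D = "\<Pi>\<^sub>M i\<in>?J. PX"
  define d h0 t where "d = real CARD('d)" and "h0 = d / (real n + 1)" and "t = 1 / (1 - h0)"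
  \<comment> \<open>The penalty tends to \<open>0\<close> because the prior standard deviation is \<open>\<sigma> sqrt (k + 1)\<close>.\<close>
  define l where "l k = inverse (real (Suc k))" for k
  define bias where "bias k = (\<integral>\<xi>. (\<Sum>b\<in>(Basis::(real^'d) set). l k * (ridge_solve (l k) ?J \<xi> b \<bullet> b)) \<partial>?D)" for k
  have "d \<le> real n" using n by (simp add: d_def)
  then have h0: "1 - h0 = (real n - d + 1) / (real n + 1)" and pos: "0 < real n - d + 1"
    by (simp_all add: h0_def field_simps)
  have t: "t * (1 - h0) = 1" using pos by (simp add: t_def h0)
  have l: "0 < l k" for k by (simp add: l_def)
  interpret D: prob_space ?D by (intro prob_space_PiM X.prob_space_axioms)
  have "ennreal (\<sigma>\<^sup>2 * (t\<^sup>2 * ((d - bias k) / (real n + 1) - h0\<^sup>2))) \<le> ?R" for k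
  proof -
    let ?f = "\<lambda>\<xi>. \<sigma>\<^sup>2 * (t\<^sup>2 * (leverage (l k) ?J \<xi> n - h0\<^sup>2))"
    have int_lev: "integrable ?D (\<lambda>\<xi>. leverage (l k) ?J \<xi> n)"
      using l by (intro integrable_leverage) auto
    then have int_f: "integrable ?D ?f" by simp
    have "(real n + 1) * (\<integral>\<xi>. leverage (l k) ?J \<xi> n \<partial>?D) = d - bias k"
      using expectation_leverage[OF l, of ?J n k] by (simp add: bias_def d_def add.commute)
    then have "(\<integral>\<xi>. leverage (l k) ?J \<xi> n \<partial>?D) = (d - bias k) / (real n + 1)"
      by (simp add: field_simps)
    then have "\<sigma>\<^sup>2 * (t\<^sup>2 * ((d - bias k) / (real n + 1) - h0\<^sup>2)) = (\<integral>\<xi>. ?f \<xi> \<partial>?D)"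
      using int_lev D.prob_space by simp
    also have "\<dots> \<le> (\<integral>\<xi>. max 0 (?f \<xi>) \<partial>?D)"
      using int_f by (intro integral_mono) auto
    finally have "ennreal (\<sigma>\<^sup>2 * (t\<^sup>2 * ((d - bias k) / (real n + 1) - h0\<^sup>2))) \<le> ennreal (\<integral>\<xi>. max 0 (?f \<xi>) \<partial>?D)"
      by (rule ennreal_leI)
    also have "\<dots> = (\<integral>\<^sup>+\<xi>. ennreal (?f \<xi>) \<partial>?D)"
      using int_f by (subst nn_integral_eq_integral[symmetric]) (auto simp: ennreal_max_0)
    also have "\<dots> \<le> (\<integral>\<^sup>+\<xi>. ennreal (\<sigma>\<^sup>2 * (ridge_solve (l k) {..<n} \<xi> (\<xi> n) \<bullet> \<xi> n)) \<partial>?D)"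
    proof (intro nn_integral_mono ennreal_leI mult_left_mono)
      fix \<xi> :: "nat \<Rightarrow> real^'d"
      show "t\<^sup>2 * (leverage (l k) ?J \<xi> n - h0\<^sup>2) \<le> ridge_solve (l k) {..<n} \<xi> (\<xi> n) \<bullet> \<xi> n"
        using ridge_variance_ge_leverage_tangent[OF l _ _ t, of "{..<n}" n k \<xi>] by (simp add: lessThan_Suc)
    qed simp
    also have "\<dots> \<le> ?R"
    proof -
      have "l k = \<sigma>\<^sup>2 / (\<sigma> * sqrt (real (Suc k)))\<^sup>2"
        using \<sigma> by (simp add: l_def power_mult_distrib divide_simps)
      moreover have "0 < \<sigma> * sqrt (real (Suc k))" using \<sigma> by simp
      ultimately show ?thesis
        using worst_case_risk_ge_ridge_variance[OF int nd bh] by simp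
    qed
    finally show ?thesis .
  qed
  moreover have "(\<lambda>k. ennreal (\<sigma>\<^sup>2 * (t\<^sup>2 * ((d - bias k) / (real n + 1) - h0\<^sup>2))))
      \<longlonglongrightarrow> ennreal (\<sigma>\<^sup>2 * (t\<^sup>2 * ((d - 0) / (real n + 1) - h0\<^sup>2)))"
  proof -
    have "bias \<longlonglongrightarrow> 0"
      unfolding bias_def using n l LIMSEQ_inverse_real_of_nat
      by (intro expectation_ridge_bias_tendsto_0 nd) (auto simp: l_def)
    then show ?thesis by (intro tendsto_intros tendsto_ennrealI) auto
  qed
  ultimately have "ennreal (\<sigma>\<^sup>2 * (t\<^sup>2 * ((d - 0) / (real n + 1) - h0\<^sup>2))) \<le> ?R"
    by (intro LIMSEQ_le_const2) auto
  also have "\<sigma>\<^sup>2 * (t\<^sup>2 * ((d - 0) / (real n + 1) - h0\<^sup>2)) = \<sigma>\<^sup>2 * d / (real n - d + 1)"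
  proof -
    have "t\<^sup>2 * (h0 - h0\<^sup>2) = t * h0 * (t * (1 - h0))" by (simp add: power2_eq_square algebra_simps)
    also have "\<dots> = d / (real n - d + 1)"
      unfolding t using pos by (simp add: t_def h0) (simp add: h0_def)
    finally show ?thesis by (simp add: h0_def)
  qed
  finally show ?thesis by (simp add: d_def)
qed

end

theorem corollary1:
  fixes PX :: "(real^'d) measure" and \<sigma> :: real and n :: nat
  assumes "prob_space PX" and "sets PX = sets borel"
    and "integrable PX (\<lambda>x. (norm x)\<^sup>2)"
    and "invertible (second_moment_matrix PX)"
    and "\<sigma> > 0"
    and "\<not> degenerate PX"
    and "n \<ge> CARD('d)"
  shows "(INF bhat\<in>estimators n. SUP P\<in>gauss_class PX \<sigma>. expected_excess_risk n P bhat)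
           \<ge> ennreal (\<sigma>\<^sup>2 * real CARD('d) / (real n - real CARD('d) + 1))"
proof -
  interpret random_design PX \<sigma> using assms by (simp add: random_design_def)
  show ?thesis using assms by (intro INF_greatest worst_case_risk_lower_bound)
qed

end
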